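(* Let $T$ be a complete totally transcendental theory eliminating imaginaries, $A$ a $\mathrm{dcl}$-closed (small) set of parameters, $M$ a prime model over $A$, and $X$ an $A$-definable set such that $X(M)=X(\mathrm{mcl}(A))$. Then each $A^{X\mathrm{DG}_n}$ ($n\ge 1$) is contained in $\mathrm{mcl}(A)$, and $$A\subseteq A^{X\mathrm{DG}_1}\subseteq A^{X\mathrm{DG}_2}\subseteq\cdots\subseteq A^{X\mathrm{DG}_\infty}\subseteq\mathrm{mcl}(A)\subseteq M.$$ Furthermore, each $A^{X\mathrm{DG}_n}$ is normal.
   Context: $A$ lies in a monster model $\bar M$ of $T$, $M\prec\bar M$, and $\mathrm{dcl}$ is computed in $\bar M$. The minimal closure of $A$ in $M$ is $\mathrm{mcl}(A)=\bigcap_\gamma\gamma(M)$, where $\gamma$ ranges over all elementary embeddings $\gamma:M\to M$ fixing $A$ pointwise. $X(B)$ is the set of points of $X$ with all coordinates in $B$. A set $A\subseteq B\subseteq M$ is normal if for all $b\in B$, $b'\in M$ with $\mathrm{tp}(b/A)=\mathrm{tp}(b'/A)$ one has $b'\in B$. Let $D$ be a set with $A\subseteq D\subseteq M$. A type $p$ over $D$ is strongly internal to $X$ if $b'\in\mathrm{dcl}(D,X(\bar M),b)$ for all realizations $b,b'$ of $p$; it is weakly orthogonal to $X$ if it has a unique extension to a complete type over $\mathrm{dcl}(D,X(\bar M))$. A definable Galois extension of finite type of $D$ relative to $X$ is a set $\mathrm{dcl}(D,b)$, with $b$ a finite tuple realizing a type over $D$ strongly internal and weakly orthogonal to $X$.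 A definable Galois extension of $D$ in $M$ relative to $X$ (an $X$-definable Galois extension) is a union of definable Galois extensions of finite type of $D$ relative to $X$ contained in $M$. $A^{X\mathrm{DG}_1}$ is the union of all $X$-definable Galois extensions of $A$ in $M$; $A^{X\mathrm{DG}_{n+1}}$ is the union of all $X$-definable Galois extensions of $A^{X\mathrm{DG}_n}$ in $M$; and $A^{X\mathrm{DG}_\infty}=\bigcup_n A^{X\mathrm{DG}_n}$. *)

theory Defs
  imports Main
begin

unbundle cardinal_syntax

section \<open>First-order logic\<close>

text \<open>
  A language is a set of function symbols and a set of relation symbols, each symbol coming with
  its arity; one name used at two arities counts as two symbols. Constants are 0-ary functions.
\<close>

record ('f, 'r) lang =
  funs :: "('f \<times> nat) set"
  rels :: "('r \<times> nat) set"

datatype 'f tm = Var nat | Fun 'f "'f tm list"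

text \<open>
  Formulas use de Bruijn indices: in the body of a quantifier, index 0 is the bound variable and
  the outer variables are shifted by one. An environment is a list, and a formula in \<open>n\<close> free
  variables is one whose free indices are below \<open>n\<close> (the second argument of \<open>wf_fm\<close>).
\<close>

datatype ('f, 'r) fm =
    Equal "'f tm" "'f tm"
  | Rel 'r "'f tm list"
  | Neg "('f, 'r) fm"
  | And "('f, 'r) fm" "('f, 'r) fm"
  | Exists "('f, 'r) fm"

fun wf_tm :: "('f, 'r) lang \<Rightarrow> nat \<Rightarrow> 'f tm \<Rightarrow> bool" where
  "wf_tm L n (Var i) \<longleftrightarrow> i < n"
| "wf_tm L n (Fun f ts) \<longleftrightarrow> (f, length ts) \<in> funs L \<and> (\<forall>t\<in>set ts. wf_tm L n t)"

fun wf_fm :: "('f, 'r) lang \<Rightarrow> nat \<Rightarrow> ('f, 'r) fm \<Rightarrow> bool" where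
  "wf_fm L n (Equal s t) \<longleftrightarrow> wf_tm L n s \<and> wf_tm L n t"
| "wf_fm L n (Rel r ts) \<longleftrightarrow> (r, length ts) \<in> rels L \<and> (\<forall>t\<in>set ts. wf_tm L n t)"
| "wf_fm L n (Neg \<phi>) \<longleftrightarrow> wf_fm L n \<phi>"
| "wf_fm L n (And \<phi> \<psi>) \<longleftrightarrow> wf_fm L n \<phi> \<and> wf_fm L n \<psi>"
| "wf_fm L n (Exists \<phi>) \<longleftrightarrow> wf_fm L (Suc n) \<phi>"

record ('a, 'f, 'r) fo_struct =
  univ :: "'a set"
  Fn :: "'f \<Rightarrow> 'a list \<Rightarrow> 'a"
  Rl :: "'r \<Rightarrow> 'a list \<Rightarrow> bool"

fun eval :: "('a, 'f, 'r) fo_struct \<Rightarrow> 'a list \<Rightarrow> 'f tm \<Rightarrow> 'a" where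
  "eval S e (Var i) = e ! i"
| "eval S e (Fun f ts) = Fn S f (map (eval S e) ts)"

fun sat :: "('a, 'f, 'r) fo_struct \<Rightarrow> 'a list \<Rightarrow> ('f, 'r) fm \<Rightarrow> bool" where
  "sat S e (Equal s t) \<longleftrightarrow> eval S e s = eval S e t"
| "sat S e (Rel r ts) \<longleftrightarrow> Rl S r (map (eval S e) ts)"
| "sat S e (Neg \<phi>) \<longleftrightarrow> \<not> sat S e \<phi>"
| "sat S e (And \<phi> \<psi>) \<longleftrightarrow> sat S e \<phi> \<and> sat S e \<psi>"
| "sat S e (Exists \<phi>) \<longleftrightarrow> (\<exists>a\<in>univ S. sat S (a # e) \<phi>)"

definition tuples :: "'a set \<Rightarrow> nat \<Rightarrow> 'a list set" where
  "tuples B n = {b \<in> lists B. length b = n}"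

definition is_structure :: "('f, 'r) lang \<Rightarrow> ('a, 'f, 'r) fo_struct \<Rightarrow> bool" where
  "is_structure L S \<longleftrightarrow> univ S \<noteq> {} \<and>
     (\<forall>(f, n) \<in> funs L. \<forall>b \<in> tuples (univ S) n. Fn S f b \<in> univ S)"

definition sentences :: "('f, 'r) lang \<Rightarrow> ('f, 'r) fm set" where
  "sentences L = {\<sigma>. wf_fm L 0 \<sigma>}"

definition is_model :: "('f, 'r) lang \<Rightarrow> ('f, 'r) fm set \<Rightarrow> ('a, 'f, 'r) fo_struct \<Rightarrow> bool" where
  "is_model L T S \<longleftrightarrow> is_structure L S \<and> (\<forall>\<sigma>\<in>T. sat S [] \<sigma>)"

text \<open>
  HOL cannot quantify over structures of all types. By the downward Loewenheim-Skolem theorem it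
  makes no difference to let consequence and satisfiability range over the structures whose
  elements are taken from one fixed type of cardinality at least that of the language and
  \<open>\<aleph>\<^sub>0\<close>; the type of formulas is such a type.
\<close>

definition entails :: "('f, 'r) lang \<Rightarrow> ('f, 'r) fm set \<Rightarrow> ('f, 'r) fm \<Rightarrow> bool" where
  "entails L T \<sigma> \<longleftrightarrow>
     (\<forall>S :: (('f, 'r) fm, 'f, 'r) fo_struct. is_model L T S \<longrightarrow> sat S [] \<sigma>)"

definition complete_theory :: "('f, 'r) lang \<Rightarrow> ('f, 'r) fm set \<Rightarrow> bool" where
  "complete_theory L T \<longleftrightarrow> T \<subseteq> sentences L \<and>
     (\<exists>S :: (('f, 'r) fm, 'f, 'r) fo_struct. is_model L T S) \<and>
     (\<forall>\<sigma>\<in>sentences L. entails L T \<sigma> \<or> entails L T (Neg \<sigma>))"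

section \<open>Definable sets, definable closure, types\<close>

text \<open>
  Everything below is relative to an ambient structure \<open>S\<close>, later the monster model. A formula in
  \<open>n\<close> variables with parameters in \<open>B\<close> is a pair \<open>(\<phi>, c)\<close>: the tuple \<open>c\<close> from \<open>B\<close> is substituted
  for the variables of \<open>\<phi>\<close> with indices \<open>n, n + 1, \<dots>\<close>.
\<close>

definition forms_over :: "('f, 'r) lang \<Rightarrow> 'a set \<Rightarrow> nat \<Rightarrow> (('f, 'r) fm \<times> 'a list) set" where
  "forms_over L B n = {(\<phi>, c). c \<in> lists B \<and> wf_fm L (n + length c) \<phi>}"

definition definable ::
  "('f, 'r) lang \<Rightarrow> ('a, 'f, 'r) fo_struct \<Rightarrow> 'a set \<Rightarrow> nat \<Rightarrow> 'a list set \<Rightarrow> bool" where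
  "definable L S B n Y \<longleftrightarrow>
     (\<exists>(\<phi>, c) \<in> forms_over L B n. Y = {b \<in> tuples (univ S) n. sat S (b @ c) \<phi>})"

definition dcl :: "('f, 'r) lang \<Rightarrow> ('a, 'f, 'r) fo_struct \<Rightarrow> 'a set \<Rightarrow> 'a set" where
  "dcl L S B = {a. definable L S B 1 {[a]}}"

definition tp ::
  "('f, 'r) lang \<Rightarrow> ('a, 'f, 'r) fo_struct \<Rightarrow> 'a list \<Rightarrow> 'a set \<Rightarrow> (('f, 'r) fm \<times> 'a list) set" where
  "tp L S b B = {(\<phi>, c) \<in> forms_over L B (length b). sat S (b @ c) \<phi>}"

text \<open>
  Complete types are maximal finitely satisfiable sets of formulas. They need not be realized in
  \<open>S\<close>, as \<open>B\<close> need not be small.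
\<close>

definition complete_type ::
  "('f, 'r) lang \<Rightarrow> ('a, 'f, 'r) fo_struct \<Rightarrow> 'a set \<Rightarrow> nat \<Rightarrow> (('f, 'r) fm \<times> 'a list) set \<Rightarrow> bool" where
  "complete_type L S B n p \<longleftrightarrow> p \<subseteq> forms_over L B n \<and>
     (\<forall>q. finite q \<and> q \<subseteq> p \<longrightarrow> (\<exists>b \<in> tuples (univ S) n. \<forall>(\<phi>, c) \<in> q. sat S (b @ c) \<phi>)) \<and>
     (\<forall>(\<phi>, c) \<in> forms_over L B n. (\<phi>, c) \<in> p \<or> (Neg \<phi>, c) \<in> p)"

definition realizations ::
  "('a, 'f, 'r) fo_struct \<Rightarrow> nat \<Rightarrow> (('f, 'r) fm \<times> 'a list) set \<Rightarrow> 'a list set" where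
  "realizations S n p = {b \<in> tuples (univ S) n. \<forall>(\<phi>, c) \<in> p. sat S (b @ c) \<phi>}"

section \<open>Elementary maps and the monster model\<close>

text \<open>Substructures of \<open>S\<close> are given by their universes \<open>N\<close>, with the induced structure.\<close>

abbreviation induced :: "('a, 'f, 'r) fo_struct \<Rightarrow> 'a set \<Rightarrow> ('a, 'f, 'r) fo_struct" where
  "induced S N \<equiv> S\<lparr>univ := N\<rparr>"

definition elem_substructure ::
  "('f, 'r) lang \<Rightarrow> ('a, 'f, 'r) fo_struct \<Rightarrow> 'a set \<Rightarrow> bool" where
  "elem_substructure L S N \<longleftrightarrow> N \<subseteq> univ S \<and> is_structure L (induced S N) \<and>
     (\<forall>n \<phi>. wf_fm L n \<phi> \<longrightarrow> (\<forall>b \<in> tuples N n. sat (induced S N) b \<phi> \<longleftrightarrow> sat S b \<phi>))"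

definition elem_embedding ::
  "('f, 'r) lang \<Rightarrow> ('a, 'f, 'r) fo_struct \<Rightarrow> ('a, 'f, 'r) fo_struct \<Rightarrow> ('a \<Rightarrow> 'a) \<Rightarrow> bool" where
  "elem_embedding L N N' \<gamma> \<longleftrightarrow> \<gamma> ` univ N \<subseteq> univ N' \<and>
     (\<forall>n \<phi>. wf_fm L n \<phi> \<longrightarrow> (\<forall>b \<in> tuples (univ N) n. sat N b \<phi> \<longleftrightarrow> sat N' (map \<gamma> b) \<phi>))"

definition automorphism ::
  "('f, 'r) lang \<Rightarrow> ('a, 'f, 'r) fo_struct \<Rightarrow> ('a \<Rightarrow> 'a) \<Rightarrow> bool" where
  "automorphism L S \<sigma> \<longleftrightarrow> bij_betw \<sigma> (univ S) (univ S) \<and>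
     (\<forall>(f, n) \<in> funs L. \<forall>b \<in> tuples (univ S) n. \<sigma> (Fn S f b) = Fn S f (map \<sigma> b)) \<and>
     (\<forall>(r, n) \<in> rels L. \<forall>b \<in> tuples (univ S) n. Rl S r b \<longleftrightarrow> Rl S r (map \<sigma> b))"

definition partial_elementary ::
  "('f, 'r) lang \<Rightarrow> ('a, 'f, 'r) fo_struct \<Rightarrow> 'a set \<Rightarrow> ('a \<Rightarrow> 'a) \<Rightarrow> bool" where
  "partial_elementary L S B f \<longleftrightarrow> B \<subseteq> univ S \<and> f ` B \<subseteq> univ S \<and>
     (\<forall>n \<phi>. wf_fm L n \<phi> \<longrightarrow> (\<forall>b \<in> tuples B n. sat S b \<phi> \<longleftrightarrow> sat S (map f b) \<phi>))"

definition small :: "'k rel \<Rightarrow> 'a set \<Rightarrow> bool" where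
  "small \<kappa> B \<longleftrightarrow> |B| <o \<kappa>"

definition saturated ::
  "('f, 'r) lang \<Rightarrow> 'k rel \<Rightarrow> ('a, 'f, 'r) fo_struct \<Rightarrow> bool" where
  "saturated L \<kappa> S \<longleftrightarrow>
     (\<forall>B n p. B \<subseteq> univ S \<and> small \<kappa> B \<and> complete_type L S B n p \<longrightarrow> realizations S n p \<noteq> {})"

definition strongly_homogeneous ::
  "('f, 'r) lang \<Rightarrow> 'k rel \<Rightarrow> ('a, 'f, 'r) fo_struct \<Rightarrow> bool" where
  "strongly_homogeneous L \<kappa> S \<longleftrightarrow>
     (\<forall>B f. small \<kappa> B \<and> partial_elementary L S B f \<longrightarrow>
        (\<exists>\<sigma>. automorphism L S \<sigma> \<and> (\<forall>b\<in>B. \<sigma> b = f b)))"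

text \<open>
  The cardinal \<open>\<kappa>\<close> is larger than the number of formulas of the language; in particular it is
  uncountable.
\<close>

definition monster ::
  "('f, 'r) lang \<Rightarrow> ('f, 'r) fm set \<Rightarrow> 'k rel \<Rightarrow> ('a, 'f, 'r) fo_struct \<Rightarrow> bool" where
  "monster L T \<kappa> S \<longleftrightarrow> Card_order \<kappa> \<and> |{\<phi>. \<exists>n. wf_fm L n \<phi>}| <o \<kappa> \<and>
     is_model L T S \<and> saturated L \<kappa> S \<and> strongly_homogeneous L \<kappa> S"

section \<open>Totally transcendental theories, elimination of imaginaries\<close>

text \<open>
  The recursion for Morley rank is: \<open>RM Y \<ge> 0\<close> iff \<open>Y\<close> is nonempty, and \<open>RM Y \<ge> \<alpha> + 1\<close> iff there
  are infinitely many pairwise disjoint definable subsets of \<open>Y\<close> of rank \<open>\<ge> \<alpha>\<close>. So \<open>RM Y \<le> \<alpha>\<close> iff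
  every sequence of pairwise disjoint nonempty definable subsets of \<open>Y\<close> has a member of rank
  \<open>< \<alpha>\<close>, and the least predicate closed under the rule below is ``\<open>RM Y < \<infinity>\<close>''. As usual the rank
  is computed in the monster model; both notions of this section are invariants of its theory.
\<close>

inductive has_morley_rank ::
  "('f, 'r) lang \<Rightarrow> ('a, 'f, 'r) fo_struct \<Rightarrow> nat \<Rightarrow> 'a list set \<Rightarrow> bool"
  for L S n where
  "has_morley_rank L S n Y"
  if "definable L S (univ S) n Y"
    and "\<forall>Z :: nat \<Rightarrow> 'a list set.
           (\<forall>i. definable L S (univ S) n (Z i) \<and> Z i \<noteq> {} \<and> Z i \<subseteq> Y) \<and>
           (\<forall>i j. i \<noteq> j \<longrightarrow> Z i \<inter> Z j = {}) \<longrightarrow>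
           (\<exists>i. has_morley_rank L S n (Z i))"

definition totally_transcendental :: "('f, 'r) lang \<Rightarrow> ('a, 'f, 'r) fo_struct \<Rightarrow> bool" where
  "totally_transcendental L S \<longleftrightarrow>
     (\<forall>n Y. definable L S (univ S) n Y \<longrightarrow> has_morley_rank L S n Y)"

text \<open>
  Every class of an equivalence relation definable without parameters is defined by some formula
  \<open>\<phi>(x, c)\<close> for exactly one parameter tuple \<open>c\<close>.
\<close>

definition eliminates_imaginaries :: "('f, 'r) lang \<Rightarrow> ('a, 'f, 'r) fo_struct \<Rightarrow> bool" where
  "eliminates_imaginaries L S \<longleftrightarrow>
     (\<forall>n E. equiv (tuples (univ S) n) E \<and>
            definable L S {} (n + n) {x @ y | x y. (x, y) \<in> E} \<longrightarrow>
        (\<forall>a \<in> tuples (univ S) n. \<exists>m \<phi>. wf_fm L (n + m) \<phi> \<and>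
           (\<exists>!c. c \<in> tuples (univ S) m \<and>
                 E `` {a} = {x \<in> tuples (univ S) n. sat S (x @ c) \<phi>})))"

section \<open>Prime models, minimal closure, normal sets\<close>

text \<open>The models are the small elementary substructures of the monster model \<open>S\<close>.\<close>

definition small_model ::
  "('f, 'r) lang \<Rightarrow> 'k rel \<Rightarrow> ('a, 'f, 'r) fo_struct \<Rightarrow> 'a set \<Rightarrow> bool" where
  "small_model L \<kappa> S N \<longleftrightarrow> elem_substructure L S N \<and> small \<kappa> N"

definition prime_model_over ::
  "('f, 'r) lang \<Rightarrow> 'k rel \<Rightarrow> ('a, 'f, 'r) fo_struct \<Rightarrow> 'a set \<Rightarrow> 'a set \<Rightarrow> bool" where
  "prime_model_over L \<kappa> S A M \<longleftrightarrow> small_model L \<kappa> S M \<and> A \<subseteq> M \<and>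
     (\<forall>N. small_model L \<kappa> S N \<and> A \<subseteq> N \<longrightarrow>
        (\<exists>\<gamma>. elem_embedding L (induced S M) (induced S N) \<gamma> \<and> (\<forall>a\<in>A. \<gamma> a = a)))"

definition mcl ::
  "('f, 'r) lang \<Rightarrow> ('a, 'f, 'r) fo_struct \<Rightarrow> 'a set \<Rightarrow> 'a set \<Rightarrow> 'a set" where
  "mcl L S M A =
     \<Inter> {\<gamma> ` M | \<gamma>. elem_embedding L (induced S M) (induced S M) \<gamma> \<and> (\<forall>a\<in>A. \<gamma> a = a)}"

definition normal_in ::
  "('f, 'r) lang \<Rightarrow> ('a, 'f, 'r) fo_struct \<Rightarrow> 'a set \<Rightarrow> 'a set \<Rightarrow> 'a set \<Rightarrow> bool" where
  "normal_in L S M A B \<longleftrightarrow> A \<subseteq> B \<and> B \<subseteq> M \<and>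
     (\<forall>b\<in>B. \<forall>b'\<in>M. tp L S [b] A = tp L S [b'] A \<longrightarrow> b' \<in> B)"

section \<open>Definable Galois extensions\<close>

text \<open>
  A definable set is given by its points in the monster model, \<open>X \<subseteq> S\<^sup>k\<close>, so that \<open>X\<close> itself is
  \<open>X(S)\<close>; as a set of parameters it contributes the coordinates of its points.
\<close>

definition points :: "'a list set \<Rightarrow> 'a set \<Rightarrow> 'a list set" where
  "points X B = X \<inter> lists B"

definition coords :: "'a list set \<Rightarrow> 'a set" where
  "coords X = (\<Union>x\<in>X. set x)"

definition strongly_internal ::
  "('f, 'r) lang \<Rightarrow> ('a, 'f, 'r) fo_struct \<Rightarrow> 'a list set \<Rightarrow> 'a set \<Rightarrow> nat \<Rightarrow>
     (('f, 'r) fm \<times> 'a list) set \<Rightarrow> bool" where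
  "strongly_internal L S X D n p \<longleftrightarrow>
     (\<forall>b \<in> realizations S n p. \<forall>b' \<in> realizations S n p.
        set b' \<subseteq> dcl L S (D \<union> coords X \<union> set b))"

definition weakly_orthogonal ::
  "('f, 'r) lang \<Rightarrow> ('a, 'f, 'r) fo_struct \<Rightarrow> 'a list set \<Rightarrow> 'a set \<Rightarrow> nat \<Rightarrow>
     (('f, 'r) fm \<times> 'a list) set \<Rightarrow> bool" where
  "weakly_orthogonal L S X D n p \<longleftrightarrow>
     (\<exists>!q. complete_type L S (dcl L S (D \<union> coords X)) n q \<and> p \<subseteq> q)"

definition galois_ext_fin ::
  "('f, 'r) lang \<Rightarrow> ('a, 'f, 'r) fo_struct \<Rightarrow> 'a list set \<Rightarrow> 'a set \<Rightarrow> 'a set \<Rightarrow> bool" where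
  "galois_ext_fin L S X D E \<longleftrightarrow>
     (\<exists>n p. complete_type L S D n p \<and> strongly_internal L S X D n p \<and>
        weakly_orthogonal L S X D n p \<and>
        (\<exists>b \<in> realizations S n p. E = dcl L S (D \<union> set b)))"

definition galois_ext ::
  "('f, 'r) lang \<Rightarrow> ('a, 'f, 'r) fo_struct \<Rightarrow> 'a list set \<Rightarrow> 'a set \<Rightarrow> 'a set \<Rightarrow> 'a set \<Rightarrow> bool" where
  "galois_ext L S X M D E \<longleftrightarrow>
     (\<exists>F. F \<noteq> {} \<and> (\<forall>E'\<in>F. galois_ext_fin L S X D E' \<and> E' \<subseteq> M) \<and> E = \<Union> F)"

text \<open>\<open>XDG L S X M A n\<close> is the \<open>n\<close>-th iterate, with the \<open>0\<close>-th iterate being \<open>A\<close> itself.\<close>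

primrec XDG ::
  "('f, 'r) lang \<Rightarrow> ('a, 'f, 'r) fo_struct \<Rightarrow> 'a list set \<Rightarrow> 'a set \<Rightarrow> 'a set \<Rightarrow> nat \<Rightarrow> 'a set" where
  "XDG L S X M A 0 = A"
| "XDG L S X M A (Suc n) = \<Union> {E. galois_ext L S X M (XDG L S X M A n) E}"

definition XDG_inf ::
  "('f, 'r) lang \<Rightarrow> ('a, 'f, 'r) fo_struct \<Rightarrow> 'a list set \<Rightarrow> 'a set \<Rightarrow> 'a set \<Rightarrow> 'a set" where
  "XDG_inf L S X M A = (\<Union>n\<in>{1..}. XDG L S X M A n)"

end

theory Submission
  imports Defs "HOL-Library.Bourbaki_Witt_Fixpoint"
begin

text \<open>
  Total transcendence is used only in the form that there is no binary tree of definable sets. Hence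
  isolated types are dense over every small set, so \<open>M\<close> contains a constructible elementary
  substructure over \<open>A\<close>, into which \<open>M\<close> embeds. It follows that \<open>M\<close> is atomic over \<open>A\<close>, and that
  tuples of \<open>M\<close> with the same type over \<open>A\<close> are conjugate under elementary self-embeddings of \<open>M\<close>
  over \<open>A\<close>.

  Let \<open>D \<subseteq> mcl(A)\<close> contain \<open>A\<close> and be invariant under these self-embeddings. Another tree argument
  shows that every tuple \<open>c\<close> of \<open>M\<close> has an isolated type over \<open>D\<close>. Given such a self-embedding
  \<open>\<gamma>\<close>, the model \<open>\<gamma>(M)\<close> thus realizes \<open>tp(c/D)\<close> by some \<open>c'\<close>; if the type is strongly internal,
  then \<open>c\<close> is definable over \<open>D\<close>, \<open>c'\<close> and points of \<open>X(M) = X(mcl(A)) \<subseteq> \<gamma>(M)\<close>, so \<open>c\<close> lies in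
  \<open>\<gamma>(M)\<close>. The Galois extensions of \<open>D\<close> in \<open>M\<close> are therefore contained in \<open>mcl(A)\<close>, their union is
  again invariant, and an invariant subset of \<open>M\<close> is normal by homogeneity.
\<close>

section \<open>Renaming of variables and definable sets\<close>

text \<open>The obstacle is isolation over \<open>D\<close>. Atomicity of \<open>M\<close> over
  \<open>A\<close> yields isolated types over \<open>A\<close> and finitely many further elements of
  \<open>M\<close>, but does not by itself reach an infinite \<open>D\<close>, and \<open>M\<close>
  is not known to be prime over \<open>D\<close>. Invariance fills the gap: a self-embedding brings
  any conjugate in \<open>M\<close> of a tuple back to that tuple and preserves \<open>D\<close> as
  a set, so a failure of isolation at the tuple is a failure at all these conjugates, which is
  enough to grow a tree.

  A self-embedding need not be onto \<open>M\<close>, so its inverse need not be one, and yet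
  invariance has to be an equality of sets. What makes up for this is that \<open>mcl(A)\<close>
  lies in every image of \<open>M\<close>: a subset of \<open>mcl(A)\<close> can be pulled back into
  \<open>M\<close>.

  Types are mostly handled as orbits. By strong homogeneity, tuples with the same type over a small
  set are conjugate, and elementary self-embeddings of \<open>M\<close> are restrictions of
  automorphisms of \<open>S\<close>, whose inverses are available.\<close>

fun ren_tm :: "(nat \<Rightarrow> nat) \<Rightarrow> 'f tm \<Rightarrow> 'f tm" where
  "ren_tm \<rho> (Var i) = Var (\<rho> i)"
| "ren_tm \<rho> (Fun f ts) = Fun f (map (ren_tm \<rho>) ts)"

fun ren_fm :: "(nat \<Rightarrow> nat) \<Rightarrow> ('f, 'r) fm \<Rightarrow> ('f, 'r) fm" where
  "ren_fm \<rho> (Equal s t) = Equal (ren_tm \<rho> s) (ren_tm \<rho> t)"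
| "ren_fm \<rho> (Rel r ts) = Rel r (map (ren_tm \<rho>) ts)"
| "ren_fm \<rho> (Neg \<phi>) = Neg (ren_fm \<rho> \<phi>)"
| "ren_fm \<rho> (And \<phi> \<psi>) = And (ren_fm \<rho> \<phi>) (ren_fm \<rho> \<psi>)"
| "ren_fm \<rho> (Exists \<phi>) = Exists (ren_fm (case_nat 0 (Suc \<circ> \<rho>)) \<phi>)"

lemma wf_ren_tm: "wf_tm L n t \<Longrightarrow> \<forall>i<n. \<rho> i < m \<Longrightarrow> wf_tm L m (ren_tm \<rho> t)"
  by (induction t) auto

lemma wf_ren_fm: "wf_fm L n \<phi> \<Longrightarrow> \<forall>i<n. \<rho> i < m \<Longrightarrow> wf_fm L m (ren_fm \<rho> \<phi>)"
proof (induction \<phi> arbitrary: n m \<rho>)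
  case (Exists \<phi>)
  have "\<forall>i<Suc n. case_nat 0 (Suc \<circ> \<rho>) i < Suc m"
    using Exists.prems(2) by (auto split: nat.split)
  with Exists show ?case by auto
qed (auto simp: wf_ren_tm)

lemma eval_ren_tm: "wf_tm L n t \<Longrightarrow> \<forall>i<n. e ! i = e' ! \<rho> i \<Longrightarrow> eval S e' (ren_tm \<rho> t) = eval S e t"
proof (induction t)
  case (Fun f ts)
  have "map (eval S e' \<circ> ren_tm \<rho>) ts = map (eval S e) ts" using Fun by auto
  then show ?case by (simp only: ren_tm.simps eval.simps map_map)
qed simp

lemma sat_ren_fm: "wf_fm L n \<phi> \<Longrightarrow> \<forall>i<n. e ! i = e' ! \<rho> i \<Longrightarrow> sat S e' (ren_fm \<rho> \<phi>) \<longleftrightarrow> sat S e \<phi>"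
proof (induction \<phi> arbitrary: n e e' \<rho>)
  case (Rel r ts)
  have "map (eval S e' \<circ> ren_tm \<rho>) ts = map (eval S e) ts"
    using Rel by (auto intro: eval_ren_tm)
  then show ?case by (simp only: ren_fm.simps sat.simps map_map)
next
  case (Exists \<phi>)
  have "sat S (a # e') (ren_fm (case_nat 0 (Suc \<circ> \<rho>)) \<phi>) \<longleftrightarrow> sat S (a # e) \<phi>" for a
    by (rule Exists.IH[of "Suc n"]) (use Exists.prems in \<open>auto split: nat.split simp: nth_Cons\<close>)
  then show ?case by simp
qed (auto simp: eval_ren_tm)

text \<open>The innermost quantifier binds index 0, so the witnesses form a block in front of
  \<open>e\<close>, with the value of the outermost quantifier last in the block.\<close>

lemma sat_Exists_funpow:
  "sat S e ((Exists ^^ n) \<phi>) \<longleftrightarrow> (\<exists>a\<in>tuples (univ S) n. sat S (a @ e) \<phi>)"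
proof (induction n arbitrary: \<phi>)
  case 0
  then show ?case by (auto simp: tuples_def)
next
  case (Suc n)
  have "sat S e ((Exists ^^ Suc n) \<phi>) \<longleftrightarrow>
      (\<exists>a\<in>tuples (univ S) n. \<exists>b\<in>univ S. sat S (b # a @ e) \<phi>)"
    using Suc[of "Exists \<phi>"] by (simp add: funpow_swap1)
  also have "\<dots> \<longleftrightarrow> (\<exists>a\<in>tuples (univ S) (Suc n). sat S (a @ e) \<phi>)"
  proof
    assume "\<exists>a\<in>tuples (univ S) n. \<exists>b\<in>univ S. sat S (b # a @ e) \<phi>"
    then obtain a b where "a \<in> tuples (univ S) n" "b \<in> univ S" "sat S ((b # a) @ e) \<phi>" by auto
    then show "\<exists>a\<in>tuples (univ S) (Suc n). sat S (a @ e) \<phi>"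
      by (intro bexI[of _ "b # a"]) (auto simp: tuples_def)
  next
    assume "\<exists>a\<in>tuples (univ S) (Suc n). sat S (a @ e) \<phi>"
    then obtain c where "c \<in> tuples (univ S) (Suc n)" "sat S (c @ e) \<phi>" by auto
    then show "\<exists>a\<in>tuples (univ S) n. \<exists>b\<in>univ S. sat S (b # a @ e) \<phi>"
      by (cases c) (auto simp: tuples_def)
  qed
  finally show ?case .
qed

lemma wf_Exists_funpow: "wf_fm L m ((Exists ^^ n) \<phi>) \<longleftrightarrow> wf_fm L (n + m) \<phi>"
  by (induction n arbitrary: m) auto

lemma tuples_append [simp]:
  "length x = n \<Longrightarrow> x @ y \<in> tuples B (n + m) \<longleftrightarrow> x \<in> tuples B n \<and> y \<in> tuples B m"
  by (auto simp: tuples_def)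

lemma tuples_mono: "B \<subseteq> C \<Longrightarrow> tuples B n \<subseteq> tuples C n"
  by (auto simp: tuples_def)

lemma tuples_splitE:
  assumes "z \<in> tuples B (n + m)"
  obtains x y where "z = x @ y" "x \<in> tuples B n" "y \<in> tuples B m"
proof (rule that[of "take n z" "drop n z"])
  show "take n z \<in> tuples B n" "drop n z \<in> tuples B m"
    using assms by (auto simp: tuples_def dest: in_set_takeD in_set_dropD)
qed simp

lemma map_nth_in_tuples:
  "z \<in> tuples B n \<Longrightarrow> \<forall>i<m. \<rho> i < n \<Longrightarrow> map (\<lambda>i. z ! \<rho> i) [0..<m] \<in> tuples B m"
  by (auto simp: tuples_def subset_iff in_lists_conv_set)

text \<open>Reordering, repetition and omission of entries become one index map, the form in which a
  renaming of variables can absorb them.\<close>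

lemma ex_index_map:
  assumes "set g \<subseteq> set h"
  obtains \<rho> where "\<forall>i<length g. \<rho> i < length h" "g = map (\<lambda>i. h ! \<rho> i) [0..<length g]"
proof -
  have "\<exists>j<length h. g ! i = h ! j" if "i < length g" for i
    using subsetD[OF assms nth_mem[OF that]] by (metis in_set_conv_nth)
  then obtain \<rho> where "\<forall>i<length g. \<rho> i < length h \<and> g ! i = h ! \<rho> i" by metis
  then show ?thesis by (intro that[of \<rho>]) (auto intro: nth_equalityI)
qed

section \<open>Closure properties of definable sets\<close>

lemma definableI:
  assumes "c \<in> lists B" "wf_fm L (n + length c) \<phi>"
    "Y = {b \<in> tuples (univ S) n. sat S (b @ c) \<phi>}"
  shows "definable L S B n Y"
  using assms by (auto simp: definable_def forms_over_def)

lemma definableE: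
  assumes "definable L S B n Y"
  obtains \<phi> c where "c \<in> lists B" "wf_fm L (n + length c) \<phi>"
    "Y = {b \<in> tuples (univ S) n. sat S (b @ c) \<phi>}"
  using assms by (auto simp: definable_def forms_over_def)

lemma definable_tuples: "definable L S B n Y \<Longrightarrow> Y \<subseteq> tuples (univ S) n"
  by (auto elim: definableE)

lemma definable_mono: "definable L S B n Y \<Longrightarrow> B \<subseteq> C \<Longrightarrow> definable L S C n Y"
  by (elim definableE, rule definableI) auto

lemma definable_finite_support:
  assumes "definable L S B n Y"
  shows "\<exists>e\<in>lists B. definable L S (set e) n Y"
proof -
  obtain \<phi> c where 1: "c \<in> lists B" "wf_fm L (n + length c) \<phi>"
    "Y = {b \<in> tuples (univ S) n. sat S (b @ c) \<phi>}" using assms by (rule definableE)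
  have "definable L S (set c) n Y" by (rule definableI[of c]) (use 1 in auto)
  then show ?thesis using 1(1) by auto
qed

lemma definable_Diff_tuples:
  assumes "definable L S B n Y"
  shows "definable L S B n (tuples (univ S) n - Y)"
proof -
  obtain \<phi> c where "c \<in> lists B" "wf_fm L (n + length c) \<phi>"
    "Y = {b \<in> tuples (univ S) n. sat S (b @ c) \<phi>}" using assms by (rule definableE)
  then show ?thesis by (intro definableI[of c _ _ _ "Neg \<phi>"]) auto
qed

lemma definable_Int:
  assumes "definable L S B n Y" "definable L S B n Z"
  shows "definable L S B n (Y \<inter> Z)"
proof -
  obtain \<phi> c where 1: "c \<in> lists B" "wf_fm L (n + length c) \<phi>"
    "Y = {b \<in> tuples (univ S) n. sat S (b @ c) \<phi>}" using assms(1) by (rule definableE)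
  obtain \<psi> d where 2: "d \<in> lists B" "wf_fm L (n + length d) \<psi>"
    "Z = {b \<in> tuples (univ S) n. sat S (b @ d) \<psi>}" using assms(2) by (rule definableE)
  \<comment> \<open>The parameters are joined to \<open>c @ d\<close>: the indices of
    \<open>\<phi>\<close> stay, those of \<open>d\<close> move past \<open>c\<close>.\<close>
  define \<rho> where "\<rho> i = (if i < n then i else i + length c)" for i
  have "sat S (b @ c @ d) (ren_fm id \<phi>) \<longleftrightarrow> sat S (b @ c) \<phi>" if "length b = n" for b
    by (rule sat_ren_fm[OF 1(2)]) (use that in \<open>auto simp: nth_append\<close>)
  moreover have "sat S (b @ c @ d) (ren_fm \<rho> \<psi>) \<longleftrightarrow> sat S (b @ d) \<psi>" if "length b = n" for b
    by (rule sat_ren_fm[OF 2(2)]) (use that in \<open>auto simp: nth_append \<rho>_def\<close>)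
  moreover have "wf_fm L (n + length (c @ d)) (ren_fm id \<phi>)"
    by (rule wf_ren_fm[OF 1(2)]) auto
  moreover have "wf_fm L (n + length (c @ d)) (ren_fm \<rho> \<psi>)"
    by (rule wf_ren_fm[OF 2(2)]) (auto simp: \<rho>_def)
  ultimately show ?thesis using 1 2
    by (intro definableI[of "c @ d" _ _ _ "And (ren_fm id \<phi>) (ren_fm \<rho> \<psi>)"])
       (auto simp: tuples_def)
qed

lemma definable_Diff:
  assumes "definable L S B n Y" "definable L S B n Z"
  shows "definable L S B n (Y - Z)"
proof -
  have "Y - Z = Y \<inter> (tuples (univ S) n - Z)" using definable_tuples[OF assms(1)] by auto
  then show ?thesis using assms by (metis definable_Int definable_Diff_tuples)
qed

text \<open>For \<open>n = 0\<close> no free variable is available, so the tautology is built from a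
  sentence; the shape \<open>\<not> (\<phi> \<and> \<not> \<phi>)\<close> keeps it true even over an
  empty universe.\<close>

lemma definable_full: "definable L S B n (tuples (univ S) n)"
proof -
  let ?\<phi> = "Exists (Equal (Var 0) (Var 0))"
  show ?thesis by (rule definableI[of "[]" _ _ _ "Neg (And ?\<phi> (Neg ?\<phi>))"]) auto
qed

lemma definable_eq_nth:
  assumes "i < n" "j < n"
  shows "definable L S B n {z \<in> tuples (univ S) n. z ! i = z ! j}"
  by (rule definableI[of "[]" _ _ _ "Equal (Var i) (Var j)"]) (use assms in auto)

text \<open>Preimages under all maps whose coordinates are variables or the constants
  \<open>g\<close>: one statement covers permutations, dummy variables and the substitution of
  parameters.\<close>

lemma definable_reindex:
  assumes "definable L S B m Z" "g \<in> lists B" "\<forall>i<m. \<rho> i < n + length g"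
    "g \<in> lists (univ S)"
  shows "definable L S B n {x \<in> tuples (univ S) n. map (\<lambda>i. (x @ g) ! \<rho> i) [0..<m] \<in> Z}"
proof -
  obtain \<phi> c where 1: "c \<in> lists B" "wf_fm L (m + length c) \<phi>"
    "Z = {b \<in> tuples (univ S) m. sat S (b @ c) \<phi>}" using assms(1) by (rule definableE)
  \<comment> \<open>The first \<open>m\<close> variables follow \<open>\<rho>\<close>; the
    parameters \<open>c\<close> of the formula now sit behind \<open>x\<close> and
    \<open>g\<close>.\<close>
  define \<sigma> where "\<sigma> i = (if i < m then \<rho> i else n + length g + (i - m))" for i
  have wf: "wf_fm L (n + length (g @ c)) (ren_fm \<sigma> \<phi>)"
    by (rule wf_ren_fm[OF 1(2)]) (use assms(3) in \<open>auto simp: \<sigma>_def less_imp_le_nat intro: trans_less_add1\<close>)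
  have sat: "sat S (x @ g @ c) (ren_fm \<sigma> \<phi>) \<longleftrightarrow> sat S (map (\<lambda>i. (x @ g) ! \<rho> i) [0..<m] @ c) \<phi>"
    if "length x = n" for x
    by (rule sat_ren_fm[OF 1(2)])
       (use that assms(3) in \<open>auto simp: nth_append \<sigma>_def; linarith\<close>)
  have tup: "map (\<lambda>i. (x @ g) ! \<rho> i) [0..<m] \<in> tuples (univ S) m" if "x \<in> tuples (univ S) n" for x
    by (rule map_nth_in_tuples[of _ _ "n + length g"])
       (use that assms(3,4) in \<open>auto simp: tuples_def\<close>)
  show ?thesis
    by (rule definableI[of "g @ c" _ _ _ "ren_fm \<sigma> \<phi>"])
       (use assms 1 wf sat tup in \<open>auto simp: tuples_def\<close>)
qed

lemma definable_proj:
  assumes "definable L S B (n + m) Z"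
  shows "definable L S B m {y. \<exists>x\<in>tuples (univ S) n. x @ y \<in> Z}"
proof -
  obtain \<phi> c where 1: "c \<in> lists B" "wf_fm L (n + m + length c) \<phi>"
    "Z = {b \<in> tuples (univ S) (n + m). sat S (b @ c) \<phi>}" using assms(1) by (rule definableE)
  have "{y. \<exists>x\<in>tuples (univ S) n. x @ y \<in> Z} =
      {y \<in> tuples (univ S) m. sat S (y @ c) ((Exists ^^ n) \<phi>)}"
    by (auto simp: 1(3) sat_Exists_funpow) (auto simp: tuples_def)
  then show ?thesis using 1
    by (intro definableI[of c _ _ _ "(Exists ^^ n) \<phi>"]) (auto simp: wf_Exists_funpow add.assoc)
qed

lemma map_nth_append_eq:
  assumes "length z = m"
  shows "map (\<lambda>i. (z @ w) ! i) [0..<m] = z"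
  using assms by (auto intro!: nth_equalityI simp: nth_append)

text \<open>A product is the intersection of the two cylinders over its factors.\<close>

lemma definable_append:
  fixes S :: "('a, 'f, 'r) fo_struct"
  assumes "definable L S B n Y" "definable L S B m Z"
  shows "definable L S B (n + m) {x @ y |x y. x \<in> Y \<and> y \<in> Z}"
proof -
  let ?P = "{z \<in> tuples (univ S) (n + m). map (\<lambda>i. (z @ []) ! i) [0..<n] \<in> Y}"
  let ?Q = "{z \<in> tuples (univ S) (n + m). map (\<lambda>i. (z @ []) ! (n + i)) [0..<m] \<in> Z}"
  have eq: "map (\<lambda>i. ((x @ y) @ []) ! i) [0..<n] = x" "map (\<lambda>i. ((x @ y) @ []) ! (n + i)) [0..<m] = y"
    if "length x = n" "length y = m" for x y :: "'a list"
    using that by (auto intro!: nth_equalityI simp: nth_append)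
  have "definable L S B (n + m) (?P \<inter> ?Q)"
    by (intro definable_Int definable_reindex assms) auto
  also have "?P \<inter> ?Q = {x @ y |x y. x \<in> Y \<and> y \<in> Z}"
  proof (intro equalityI subsetI)
    fix z assume z: "z \<in> ?P \<inter> ?Q"
    then obtain x y where "z = x @ y" "x \<in> tuples (univ S) n" "y \<in> tuples (univ S) m"
      by (auto elim: tuples_splitE)
    then show "z \<in> {x @ y |x y. x \<in> Y \<and> y \<in> Z}"
      using z eq[of x y] by (auto simp: tuples_def)
  next
    fix z assume "z \<in> {x @ y |x y. x \<in> Y \<and> y \<in> Z}"
    then obtain x y where "z = x @ y" "x \<in> Y" "y \<in> Z" by auto
    moreover have "x \<in> tuples (univ S) n" "y \<in> tuples (univ S) m"
      using calculation assms[THEN definable_tuples] by auto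
    ultimately show "z \<in> ?P \<inter> ?Q" using eq[of x y] by (auto simp: tuples_def)
  qed
  finally show ?thesis .
qed

lemma definable_fix_right:
  assumes "definable L S B (n + m) Z" "f \<in> tuples (univ S) m"
  shows "definable L S (B \<union> set f) n {x. x @ f \<in> Z}"
proof -
  have len: "length f = m" using assms(2) by (auto simp: tuples_def)
  have "definable L S (B \<union> set f) n
      {x \<in> tuples (univ S) n. map (\<lambda>i. (x @ f) ! i) [0..<n + m] \<in> Z}"
    by (rule definable_reindex[OF definable_mono[OF assms(1)]]) (use assms(2) len in \<open>auto simp: tuples_def\<close>)
  also have "{x \<in> tuples (univ S) n. map (\<lambda>i. (x @ f) ! i) [0..<n + m] \<in> Z} = {x. x @ f \<in> Z}"
  proof (intro equalityI subsetI)
    fix x assume "x \<in> {x. x @ f \<in> Z}"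
    then have "x @ f \<in> Z" "x @ f \<in> tuples (univ S) (n + m)"
      using definable_tuples[OF assms(1)] by auto
    moreover from this have "length x = n" using len by (auto simp: tuples_def)
    ultimately show "x \<in> {x \<in> tuples (univ S) n. map (\<lambda>i. (x @ f) ! i) [0..<n + m] \<in> Z}"
      using map_nth_append_eq[of "x @ f" "n + m" "[]"] len by (auto simp: tuples_def)
  next
    fix x assume "x \<in> {x \<in> tuples (univ S) n. map (\<lambda>i. (x @ f) ! i) [0..<n + m] \<in> Z}"
    then show "x \<in> {x. x @ f \<in> Z}"
      using map_nth_append_eq[of "x @ f" "n + m" "[]"] len by (auto simp: tuples_def)
  qed
  finally show ?thesis .
qed

lemma definable_fix_left:
  assumes "definable L S B (n + m) Z" "f \<in> tuples (univ S) n"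
  shows "definable L S (B \<union> set f) m {y. f @ y \<in> Z}"
proof -
  have len: "length f = n" using assms(2) by (auto simp: tuples_def)
  \<comment> \<open>Parameters have to stand behind the variables, so the two blocks are
    swapped.\<close>
  define \<rho> where "\<rho> i = (if i < n then m + i else i - n)" for i
  have eq: "map (\<lambda>i. (y @ f) ! \<rho> i) [0..<n + m] = f @ y" if "length y = m" for y
    using that len by (auto intro!: nth_equalityI simp: nth_append \<rho>_def)
  have "definable L S (B \<union> set f) m
      {y \<in> tuples (univ S) m. map (\<lambda>i. (y @ f) ! \<rho> i) [0..<n + m] \<in> Z}"
    by (rule definable_reindex[OF definable_mono[OF assms(1)]])
       (use assms(2) len in \<open>auto simp: tuples_def \<rho>_def\<close>)
  also have "{y \<in> tuples (univ S) m. map (\<lambda>i. (y @ f) ! \<rho> i) [0..<n + m] \<in> Z} = {y. f @ y \<in> Z}"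
  proof (intro equalityI subsetI)
    fix y assume "y \<in> {y. f @ y \<in> Z}"
    then have "f @ y \<in> Z" "f @ y \<in> tuples (univ S) (n + m)"
      using definable_tuples[OF assms(1)] by auto
    moreover from this have "length y = m" using len by (auto simp: tuples_def)
    ultimately show "y \<in> {y \<in> tuples (univ S) m. map (\<lambda>i. (y @ f) ! \<rho> i) [0..<n + m] \<in> Z}"
      using eq by (auto simp: tuples_def)
  qed (use eq in \<open>auto simp: tuples_def\<close>)
  finally show ?thesis .
qed

text \<open>Turns a set defined with the parameters \<open>f\<close> into a fibre of a family over
  \<open>B\<close>, so that \<open>f\<close> can later be varied.\<close>

lemma definable_abstract:
  assumes "definable L S (B \<union> set f) n Y" "B \<subseteq> univ S" "set f \<subseteq> univ S"
  obtains Z where "definable L S B (n + length f) Z" "Y = {x. x @ f \<in> Z}"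
proof -
  obtain \<phi> c where 1: "c \<in> lists (B \<union> set f)" "wf_fm L (n + length c) \<phi>"
    "Y = {b \<in> tuples (univ S) n. sat S (b @ c) \<phi>}" using assms(1) by (rule definableE)
  \<comment> \<open>Every entry of \<open>c\<close> outside \<open>B\<close> occurs in
    \<open>f\<close>, so \<open>f @ g\<close> lists all parameters that are used.\<close>
  define g where "g = filter (\<lambda>a. a \<in> B) c"
  have "set c \<subseteq> set (f @ g)" using 1(1) by (auto simp: g_def)
  then obtain \<rho> where \<rho>: "\<forall>i<length c. \<rho> i < length (f @ g)"
    "c = map (\<lambda>i. (f @ g) ! \<rho> i) [0..<length c]" by (rule ex_index_map)
  define \<sigma> where "\<sigma> i = (if i < n then i else n + \<rho> (i - n))" for i
  have c_nth: "c ! i = (f @ g) ! \<rho> i" if "i < length c" for i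
    using that \<rho>(2) by (metis (no_types, lifting) add_0 diff_zero nth_map_upt)
  have wf: "wf_fm L (n + length f + length g) (ren_fm \<sigma> \<phi>)"
    by (rule wf_ren_fm[OF 1(2)]) (use \<rho>(1) in \<open>auto simp: \<sigma>_def add.assoc\<close>)
  have sat: "sat S (x @ f @ g) (ren_fm \<sigma> \<phi>) \<longleftrightarrow> sat S (x @ c) \<phi>" if "length x = n" for x
    by (rule sat_ren_fm[OF 1(2)]) (use that c_nth in \<open>auto simp: nth_append_left nth_append_right \<sigma>_def\<close>)
  define Z where "Z = {z \<in> tuples (univ S) (n + length f). sat S (z @ g) (ren_fm \<sigma> \<phi>)}"
  have "definable L S B (n + length f) Z"
    by (rule definableI[of g]) (use wf in \<open>auto simp: Z_def g_def\<close>)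
  moreover have "Y = {x. x @ f \<in> Z}"
    using sat assms(3) by (auto simp: 1(3) Z_def tuples_def)
  ultimately show ?thesis by (rule that)
qed

text \<open>The image is the projection of the graph, and the graph is cut out by finitely many
  equations between coordinates, added one at a time.\<close>

lemma definable_image_nth:
  assumes "definable L S B n Y" "\<forall>i<m. \<rho> i < n"
  shows "definable L S B m ((\<lambda>y. map (\<lambda>i. y ! \<rho> i) [0..<m]) ` Y)"
proof -
  let ?E = "\<lambda>k. {z \<in> tuples (univ S) (n + m). \<forall>i<k. z ! (n + i) = z ! \<rho> i}"
  have E: "definable L S B (n + m) (?E k)" if "k \<le> m" for k
    using that
  proof (induction k)
    case 0
    then show ?case using definable_full[of L S B "n + m"] by simp
  next
    case (Suc k)
    have "?E (Suc k) = ?E k \<inter> {z \<in> tuples (univ S) (n + m). z ! (n + k) = z ! \<rho> k}"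
      by (auto simp: less_Suc_eq)
    moreover have "\<rho> k < n + m" using Suc.prems assms(2) by (simp add: trans_less_add1)
    ultimately show ?case using Suc by (auto intro!: definable_Int definable_eq_nth)
  qed
  let ?Z = "?E m \<inter> {x @ y |x y. x \<in> Y \<and> y \<in> tuples (univ S) m}"
  have "definable L S B (n + m) ?Z"
    by (intro definable_Int E definable_append assms(1) definable_full) simp
  from definable_proj[OF this]
  have "definable L S B m {y. \<exists>x\<in>tuples (univ S) n. x @ y \<in> ?Z}" .
  also have "{y. \<exists>x\<in>tuples (univ S) n. x @ y \<in> ?Z} = (\<lambda>y. map (\<lambda>i. y ! \<rho> i) [0..<m]) ` Y"
  proof (intro equalityI subsetI)
    fix y assume "y \<in> {y. \<exists>x\<in>tuples (univ S) n. x @ y \<in> ?Z}"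
    then obtain x where x: "x \<in> tuples (univ S) n" "x @ y \<in> ?Z" by auto
    then obtain x' y' where *: "x @ y = x' @ y'" "x' \<in> Y" "y' \<in> tuples (univ S) m" by auto
    moreover have "length x' = n" using *(2) definable_tuples[OF assms(1)] by (auto simp: tuples_def)
    ultimately have "x \<in> Y" "length y = m" using x(1) by (auto simp: tuples_def)
    moreover have "y = map (\<lambda>i. x ! \<rho> i) [0..<m]"
    proof (rule nth_equalityI)
      fix i assume i: "i < length y"
      then have "(x @ y) ! (n + i) = (x @ y) ! \<rho> i" using x(2) \<open>length y = m\<close> by auto
      then show "y ! i = map (\<lambda>i. x ! \<rho> i) [0..<m] ! i"
        using i x(1) \<open>length y = m\<close> assms(2) by (auto simp: tuples_def nth_append_left nth_append_right)
    qed (simp add: \<open>length y = m\<close>)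
    ultimately show "y \<in> (\<lambda>y. map (\<lambda>i. y ! \<rho> i) [0..<m]) ` Y" by auto
  next
    fix y assume "y \<in> (\<lambda>y. map (\<lambda>i. y ! \<rho> i) [0..<m]) ` Y"
    then obtain x where x: "x \<in> Y" "y = map (\<lambda>i. x ! \<rho> i) [0..<m]" by auto
    have x': "x \<in> tuples (univ S) n" using x(1) definable_tuples[OF assms(1)] by auto
    have y: "y \<in> tuples (univ S) m" unfolding x(2) by (rule map_nth_in_tuples[OF x' assms(2)])
    have "x @ y \<in> ?E m"
      using x' y assms(2) x(2) by (auto simp: tuples_def nth_append_left nth_append_right)
    then have "x @ y \<in> ?Z" using x(1) y by auto
    then show "y \<in> {y. \<exists>x\<in>tuples (univ S) n. x @ y \<in> ?Z}" using x' by auto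
  qed
  finally show ?thesis .
qed

lemma definable_singleton: "a \<in> B \<Longrightarrow> a \<in> univ S \<Longrightarrow> definable L S B 1 {[a]}"
  by (rule definableI[of "[a]" _ _ _ "Equal (Var 0) (Var 1)"])
     (auto simp: tuples_def length_Suc_conv)

lemma dcl_subset: "B \<subseteq> univ S \<Longrightarrow> B \<subseteq> dcl L S B"
  using definable_singleton by (fastforce simp: dcl_def)

lemma dcl_univ: "dcl L S B \<subseteq> univ S"
  by (auto simp: dcl_def tuples_def dest!: definable_tuples)

section \<open>Automorphisms and isolated types\<close>

text \<open>Bijections of the whole type, not only of \<open>univ S\<close>, so that
  \<open>inv \<sigma>\<close> is a two-sided inverse everywhere and the set is a group under
  composition.\<close>

definition auts :: "('f, 'r) lang \<Rightarrow> ('a, 'f, 'r) fo_struct \<Rightarrow> 'a set \<Rightarrow> ('a \<Rightarrow> 'a) set" where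
  "auts L S B = {\<sigma>. bij \<sigma> \<and> \<sigma> ` univ S = univ S \<and>
     (\<forall>n \<phi>. wf_fm L n \<phi> \<longrightarrow> (\<forall>b\<in>tuples (univ S) n. sat S b \<phi> \<longleftrightarrow> sat S (map \<sigma> b) \<phi>)) \<and>
     (\<forall>a\<in>B. \<sigma> a = a)}"

text \<open>Being in the same orbit over \<open>B\<close>. For small \<open>B\<close> in a strongly
  homogeneous structure this is equality of types over \<open>B\<close>.\<close>

definition conj_over ::
  "('f, 'r) lang \<Rightarrow> ('a, 'f, 'r) fo_struct \<Rightarrow> 'a set \<Rightarrow> 'a list \<Rightarrow> 'a list \<Rightarrow> bool" where
  "conj_over L S B c c' \<longleftrightarrow> (\<exists>\<sigma>\<in>auts L S B. map \<sigma> c = c')"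

text \<open>Isolation of the type of \<open>c\<close> over \<open>B\<close> in orbit form: a
  \<open>B\<close>-definable set around \<open>c\<close> inside the orbit of \<open>c\<close>. For
  small \<open>B\<close> in a strongly homogeneous structure it is the usual notion.\<close>

definition isolated ::
  "('f, 'r) lang \<Rightarrow> ('a, 'f, 'r) fo_struct \<Rightarrow> 'a list \<Rightarrow> 'a set \<Rightarrow> bool" where
  "isolated L S c B \<longleftrightarrow>
     (\<exists>Y. definable L S B (length c) Y \<and> c \<in> Y \<and> (\<forall>c'\<in>Y. conj_over L S B c c'))"

lemma map_in_tuples: "\<sigma> ` N \<subseteq> N' \<Longrightarrow> b \<in> tuples N n \<Longrightarrow> map \<sigma> b \<in> tuples N' n"
  by (auto simp: tuples_def subset_iff)

lemma auts_sat:
  assumes "\<sigma> \<in> auts L S B" "b \<in> lists (univ S)" "wf_fm L (length b) \<phi>"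
  shows "sat S (map \<sigma> b) \<phi> \<longleftrightarrow> sat S b \<phi>"
  using assms by (auto simp: auts_def tuples_def)

lemma auts_fix: "\<sigma> \<in> auts L S B \<Longrightarrow> a \<in> B \<Longrightarrow> \<sigma> a = a"
  by (simp add: auts_def)

lemma auts_fix_lists: "\<sigma> \<in> auts L S B \<Longrightarrow> b \<in> lists B \<Longrightarrow> map \<sigma> b = b"
  by (auto simp: map_idI auts_fix)

lemma auts_image: "\<sigma> \<in> auts L S B \<Longrightarrow> \<sigma> ` univ S = univ S"
  by (simp add: auts_def)

lemma auts_bij: "\<sigma> \<in> auts L S B \<Longrightarrow> bij \<sigma>"
  by (simp add: auts_def)

lemma auts_in_univ: "\<sigma> \<in> auts L S B \<Longrightarrow> \<sigma> a \<in> univ S \<longleftrightarrow> a \<in> univ S"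
  using auts_image auts_bij by (metis bij_is_inj inj_image_mem_iff)

lemma auts_map_tuples: "\<sigma> \<in> auts L S B \<Longrightarrow> map \<sigma> b \<in> tuples (univ S) n \<longleftrightarrow> b \<in> tuples (univ S) n"
  by (auto simp: tuples_def auts_in_univ)

lemma auts_mono: "\<sigma> \<in> auts L S C \<Longrightarrow> B \<subseteq> C \<Longrightarrow> \<sigma> \<in> auts L S B"
  by (auto simp: auts_def)

lemma auts_id: "id \<in> auts L S B"
  by (simp add: auts_def)

lemma auts_comp:
  assumes "\<sigma> \<in> auts L S B" "\<tau> \<in> auts L S B"
  shows "\<sigma> \<circ> \<tau> \<in> auts L S B"
proof -
  have "sat S (map (\<sigma> \<circ> \<tau>) b) \<phi> \<longleftrightarrow> sat S b \<phi>"
    if "wf_fm L n \<phi>" "b \<in> tuples (univ S) n" for n \<phi> b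
  proof -
    have "sat S (map \<sigma> (map \<tau> b)) \<phi> \<longleftrightarrow> sat S (map \<tau> b) \<phi>"
      by (rule auts_sat[OF assms(1)]) (use that assms in \<open>auto simp: tuples_def auts_in_univ\<close>)
    also have "\<dots> \<longleftrightarrow> sat S b \<phi>"
      by (rule auts_sat[OF assms(2)]) (use that in \<open>auto simp: tuples_def\<close>)
    finally show ?thesis by simp
  qed
  moreover have "(\<sigma> \<circ> \<tau>) ` univ S = univ S" using assms by (metis auts_image image_comp)
  moreover have "bij (\<sigma> \<circ> \<tau>)" using assms by (simp add: bij_comp auts_bij)
  ultimately show ?thesis using assms by (auto simp: auts_def)
qed

lemma auts_inv_inv: "\<sigma> \<in> auts L S B \<Longrightarrow> \<sigma> (inv \<sigma> x) = x" "\<sigma> \<in> auts L S B \<Longrightarrow> inv \<sigma> (\<sigma> x) = x"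
  by (simp_all add: auts_bij bij_is_inj bij_is_surj surj_f_inv_f)

lemma auts_inv:
  assumes "\<sigma> \<in> auts L S B"
  shows "inv \<sigma> \<in> auts L S B"
proof -
  note [simp] = auts_inv_inv[OF assms]
  have "inv \<sigma> ` univ S = univ S"
    using assms by (metis auts_bij auts_image bij_is_inj image_inv_f_f)
  moreover have "sat S (map (inv \<sigma>) b) \<phi> \<longleftrightarrow> sat S b \<phi>"
    if "wf_fm L n \<phi>" "b \<in> tuples (univ S) n" for n \<phi> b
  proof -
    have "map (inv \<sigma>) b \<in> tuples (univ S) n"
      using that calculation by (intro map_in_tuples[of _ "univ S"]) auto
    then have "sat S (map \<sigma> (map (inv \<sigma>) b)) \<phi> \<longleftrightarrow> sat S (map (inv \<sigma>) b) \<phi>"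
      using that by (intro auts_sat[OF assms]) (auto simp: tuples_def)
    then show ?thesis by (simp add: comp_def)
  qed
  moreover have "bij (inv \<sigma>)" using assms auts_bij bij_imp_bij_inv by blast
  moreover have "inv \<sigma> a = a" if "a \<in> B" for a
    using assms that by (metis auts_fix auts_inv_inv(2))
  ultimately show ?thesis by (auto simp: auts_def)
qed

lemma auts_definable_image:
  assumes "\<sigma> \<in> auts L S B'" "definable L S B n Y" "B \<subseteq> univ S"
  shows "definable L S (\<sigma> ` B) n (map \<sigma> ` Y)"
proof -
  obtain \<phi> c where 1: "c \<in> lists B" "wf_fm L (n + length c) \<phi>"
    "Y = {b \<in> tuples (univ S) n. sat S (b @ c) \<phi>}" using assms(2) by (rule definableE)
  have sat: "sat S (map \<sigma> b @ map \<sigma> c) \<phi> \<longleftrightarrow> sat S (b @ c) \<phi>" if "b \<in> tuples (univ S) n" for b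
    using auts_sat[OF assms(1), of "b @ c" \<phi>] that 1 assms(3) by (auto simp: tuples_def)
  have "b \<in> map \<sigma> ` Y" if "b \<in> tuples (univ S) n" "sat S (b @ map \<sigma> c) \<phi>" for b
  proof -
    have b: "b = map \<sigma> (map (inv \<sigma>) b)" using assms(1) by (simp add: auts_inv_inv comp_def)
    have "map (inv \<sigma>) b \<in> tuples (univ S) n"
      using auts_map_tuples[OF auts_inv[OF assms(1)]] that(1) by blast
    moreover have "sat S (map (inv \<sigma>) b @ c) \<phi>" using sat[OF calculation] b that(2) by simp
    ultimately have "map (inv \<sigma>) b \<in> Y" by (simp add: 1(3))
    then show ?thesis using b by blast
  qed
  then have "map \<sigma> ` Y = {b \<in> tuples (univ S) n. sat S (b @ map \<sigma> c) \<phi>}"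
    using sat assms(1) by (auto simp: 1(3) auts_map_tuples)
  then show ?thesis by (rule definableI[rotated 2]) (use 1 in auto)
qed

lemma auts_definable_iff:
  assumes "\<sigma> \<in> auts L S B" "definable L S B n Y" "B \<subseteq> univ S"
  shows "map \<sigma> c \<in> Y \<longleftrightarrow> c \<in> Y"
proof -
  obtain \<phi> d where 1: "d \<in> lists B" "wf_fm L (n + length d) \<phi>"
    "Y = {b \<in> tuples (univ S) n. sat S (b @ d) \<phi>}" using assms(2) by (rule definableE)
  have "sat S (map \<sigma> c @ d) \<phi> \<longleftrightarrow> sat S (c @ d) \<phi>" if "c \<in> tuples (univ S) n"
    using auts_sat[OF assms(1), of "c @ d" \<phi>] auts_fix_lists[OF assms(1) 1(1)] that 1 assms(3)
    by (auto simp: tuples_def)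
  then show ?thesis by (auto simp: 1(3) auts_map_tuples[OF assms(1)])
qed

lemma auts_dcl_image:
  assumes "\<sigma> \<in> auts L S B'" "B \<subseteq> univ S"
  shows "\<sigma> ` dcl L S B = dcl L S (\<sigma> ` B)"
proof -
  have *: "\<tau> ` dcl L S C \<subseteq> dcl L S (\<tau> ` C)" if "\<tau> \<in> auts L S B'" "C \<subseteq> univ S" for \<tau> C
    using auts_definable_image[OF that(1) _ that(2)] by (fastforce simp: dcl_def)
  have "dcl L S (\<sigma> ` B) \<subseteq> \<sigma> ` dcl L S B"
  proof
    fix x assume "x \<in> dcl L S (\<sigma> ` B)"
    moreover have "\<sigma> ` B \<subseteq> univ S" using assms auts_in_univ by fastforce
    ultimately have "inv \<sigma> x \<in> dcl L S (inv \<sigma> ` \<sigma> ` B)"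
      using *[OF auts_inv[OF assms(1)]] by blast
    then have "inv \<sigma> x \<in> dcl L S B"
      using assms(1) by (simp add: image_image auts_inv_inv)
    then show "x \<in> \<sigma> ` dcl L S B" using auts_inv_inv(1)[OF assms(1)] by (metis image_eqI)
  qed
  with *[OF assms] show ?thesis by auto
qed

lemma conj_over_refl: "conj_over L S B c c"
  using auts_id by (force simp: conj_over_def)

lemma conj_over_sym: "conj_over L S B c c' \<Longrightarrow> conj_over L S B c' c"
  unfolding conj_over_def by (metis auts_inv auts_inv_inv(2) map_idI map_map comp_apply)

lemma conj_over_trans: "conj_over L S B c c' \<Longrightarrow> conj_over L S B c' c'' \<Longrightarrow> conj_over L S B c c''"
  unfolding conj_over_def by (metis auts_comp map_map)

lemma conj_over_mono: "conj_over L S C c c' \<Longrightarrow> B \<subseteq> C \<Longrightarrow> conj_over L S B c c'"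
  unfolding conj_over_def by (meson auts_mono)

lemma conj_over_transport:
  assumes "\<tau> \<in> auts L S B'" "conj_over L S B c c'"
  shows "conj_over L S (\<tau> ` B) (map \<tau> c) (map \<tau> c')"
proof -
  obtain \<sigma> where \<sigma>: "\<sigma> \<in> auts L S B" "map \<sigma> c = c'" using assms(2) by (auto simp: conj_over_def)
  have "\<tau> \<circ> \<sigma> \<circ> inv \<tau> \<in> auts L S {}"
    using assms(1) \<sigma>(1) by (meson auts_comp auts_inv auts_mono empty_subsetI)
  moreover have "\<forall>a\<in>\<tau> ` B. (\<tau> \<circ> \<sigma> \<circ> inv \<tau>) a = a"
    using auts_fix[OF \<sigma>(1)] auts_inv_inv[OF assms(1)] by auto
  ultimately have "\<tau> \<circ> \<sigma> \<circ> inv \<tau> \<in> auts L S (\<tau> ` B)" by (auto simp: auts_def)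
  moreover have "map (\<tau> \<circ> \<sigma> \<circ> inv \<tau>) (map \<tau> c) = map \<tau> c'"
    using auts_inv_inv[OF assms(1)] by (simp add: \<sigma>(2)[symmetric])
  ultimately show ?thesis by (auto simp: conj_over_def)
qed

lemma isolated_transport:
  assumes "\<tau> \<in> auts L S B'" "isolated L S c B" "B \<subseteq> univ S"
  shows "isolated L S (map \<tau> c) (\<tau> ` B)"
proof -
  obtain Y where Y: "definable L S B (length c) Y" "c \<in> Y" "\<forall>c'\<in>Y. conj_over L S B c c'"
    using assms(2) by (auto simp: isolated_def)
  show ?thesis unfolding isolated_def
    using auts_definable_image[OF assms(1) Y(1) assms(3)] Y(2,3) conj_over_transport[OF assms(1)]
    by (intro exI[of _ "map \<tau> ` Y"]) auto
qed

section \<open>Calculus of isolated types\<close>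

lemma isolated_self:
  assumes "a \<in> B" "a \<in> univ S"
  shows "isolated L S [a] B"
  unfolding isolated_def using assms definable_singleton[of a B S L]
  by (intro exI[of _ "{[a]}"]) (auto simp: conj_over_refl)

lemma isolated_Nil: "isolated L S [] B"
  unfolding isolated_def using definable_full[of L S B 0]
  by (intro exI[of _ "tuples (univ S) 0"]) (auto simp: conj_over_refl tuples_def)

text \<open>Selecting coordinates commutes with automorphisms, so the projection of the isolating
  set lies in the orbit of the subtuple. Reorderings and repetitions are included.\<close>

lemma isolated_subtuple:
  assumes "isolated L S y B" "set x \<subseteq> set y"
  shows "isolated L S x B"
proof -
  obtain Y where Y: "definable L S B (length y) Y" "y \<in> Y" "\<forall>c'\<in>Y. conj_over L S B y c'"
    using assms(1) by (auto simp: isolated_def)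
  obtain \<rho> where \<rho>: "\<forall>i<length x. \<rho> i < length y" "x = map (\<lambda>i. y ! \<rho> i) [0..<length x]"
    using assms(2) by (rule ex_index_map)
  let ?f = "\<lambda>y. map (\<lambda>i. y ! \<rho> i) [0..<length x]"
  have f_map: "?f (map \<sigma> y) = map \<sigma> (?f y)" for \<sigma> using \<rho>(1) by auto
  have "conj_over L S B x c'" if "c' \<in> ?f ` Y" for c'
  proof -
    obtain y' where y': "y' \<in> Y" "c' = ?f y'" using \<open>c' \<in> ?f ` Y\<close> by blast
    then obtain \<sigma> where \<sigma>: "\<sigma> \<in> auts L S B" "map \<sigma> y = y'" using Y(3) by (auto simp: conj_over_def)
    have "c' = map \<sigma> x" using f_map[of \<sigma>] \<rho>(2) \<sigma>(2) y'(2) by metis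
    then show ?thesis using \<sigma>(1) by (auto simp: conj_over_def)
  qed
  moreover have "x \<in> ?f ` Y" using \<rho>(2) Y(2) by (rule image_eqI)
  ultimately show ?thesis
    unfolding isolated_def using definable_image_nth[OF Y(1) \<rho>(1)] by blast
qed

text \<open>The fibre over \<open>e\<close> isolates: an automorphism taking \<open>c @ e\<close> to
  \<open>c' @ e\<close> fixes \<open>e\<close>.\<close>

lemma isolated_right:
  assumes "isolated L S (c @ e) B" "set e \<subseteq> univ S"
  shows "isolated L S c (B \<union> set e)"
proof -
  obtain Y where Y: "definable L S B (length c + length e) Y" "c @ e \<in> Y"
      "\<forall>c'\<in>Y. conj_over L S B (c @ e) c'"
    using assms(1) by (auto simp: isolated_def)
  have "conj_over L S (B \<union> set e) c c'" if c': "c' @ e \<in> Y" for c'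
  proof -
    obtain \<sigma> where \<sigma>: "\<sigma> \<in> auts L S B" "map \<sigma> (c @ e) = c' @ e"
      using Y(3) c' by (auto simp: conj_over_def)
    have eq: "map \<sigma> c = c'" "map \<sigma> e = e" using \<sigma>(2) by simp_all
    from eq(2) have "\<forall>a\<in>set e. \<sigma> a = a" by (metis in_set_conv_nth nth_map)
    then have "\<sigma> \<in> auts L S (B \<union> set e)" using \<sigma>(1) by (auto simp: auts_def)
    then show ?thesis using eq(1) by (auto simp: conj_over_def)
  qed
  moreover have "definable L S (B \<union> set e) (length c) {x. x @ e \<in> Y}"
    by (rule definable_fix_right[OF Y(1)]) (use assms(2) in \<open>auto simp: tuples_def\<close>)
  ultimately show ?thesis unfolding isolated_def using Y(2) by blast
qed

text \<open>Transitivity of isolation: the pair is isolated by the formula for \<open>c\<close> with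
  \<open>f\<close> made a variable, together with the formula for \<open>f\<close>.\<close>

lemma isolated_append:
  assumes c: "isolated L S c (B \<union> set f)" and f: "isolated L S f B"
    and B: "B \<subseteq> univ S" "set f \<subseteq> univ S"
  shows "isolated L S (c @ f) B"
proof -
  obtain Y where Y: "definable L S (B \<union> set f) (length c) Y" "c \<in> Y"
      "\<forall>c'\<in>Y. conj_over L S (B \<union> set f) c c'"
    using c by (auto simp: isolated_def)
  obtain Y' where Y': "definable L S B (length c + length f) Y'" "Y = {x. x @ f \<in> Y'}"
    using definable_abstract[OF Y(1) B] by blast
  obtain Z where Z: "definable L S B (length f) Z" "f \<in> Z" "\<forall>c'\<in>Z. conj_over L S B f c'"
    using f by (auto simp: isolated_def)
  let ?W = "Y' \<inter> {x @ y |x y. x \<in> tuples (univ S) (length c) \<and> y \<in> Z}"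
  have "c \<in> tuples (univ S) (length c)" using Y(1,2) definable_tuples by blast
  then have "c @ f \<in> ?W" using Y(2) Y'(2) Z(2) by auto
  moreover have "definable L S B (length (c @ f)) ?W"
    using definable_Int[OF Y'(1) definable_append[OF definable_full Z(1)]] by simp
  moreover have "conj_over L S B (c @ f) w" if "w \<in> ?W" for w
  proof -
    obtain x y where w: "w = x @ y" "x @ y \<in> Y'" "x \<in> tuples (univ S) (length c)" "y \<in> Z"
      using \<open>w \<in> ?W\<close> by auto
    \<comment> \<open>The second components are matched first; \<open>\<sigma>\<close> fixes
      \<open>B\<close>, so the first component then lands in the fibre \<open>Y\<close> over
      \<open>f\<close>.\<close>
    obtain \<sigma> where \<sigma>: "\<sigma> \<in> auts L S B" "map \<sigma> y = f"
      using conj_over_sym[OF Z(3)[rule_format, OF w(4)]] by (auto simp: conj_over_def)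
    have "map \<sigma> x @ f \<in> Y'" using auts_definable_iff[OF \<sigma>(1) Y'(1) B(1), of "x @ y"] w(2) \<sigma>(2) by simp
    then have "map \<sigma> x \<in> Y" by (simp add: Y'(2))
    then have "conj_over L S (B \<union> set f) c (map \<sigma> x)" using Y(3) by simp
    then obtain \<tau> where \<tau>: "\<tau> \<in> auts L S (B \<union> set f)" "map \<tau> c = map \<sigma> x"
      by (auto simp: conj_over_def)
    have "map \<tau> f = f" using auts_fix_lists[OF \<tau>(1)] by auto
    then have "map \<tau> (c @ f) = map \<sigma> w" using \<tau>(2) \<sigma>(2) w(1) by simp
    moreover have "\<tau> \<in> auts L S B" using \<tau>(1) by (rule auts_mono) simp
    ultimately have "conj_over L S B (c @ f) (map \<sigma> w)" unfolding conj_over_def by blast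
    moreover have "conj_over L S B w (map \<sigma> w)" using \<sigma>(1) unfolding conj_over_def by blast
    ultimately show ?thesis using conj_over_trans conj_over_sym by blast
  qed
  ultimately show ?thesis unfolding isolated_def by blast
qed

text \<open>The isolating formula mentions finitely many parameters, and it still isolates over any
  intermediate \<open>B\<close> because orbits only grow when parameters are dropped.\<close>

lemma isolated_finite_support:
  assumes "isolated L S c C"
  shows "\<exists>e\<in>lists C. \<forall>B. set e \<subseteq> B \<and> B \<subseteq> C \<longrightarrow> isolated L S c B"
proof -
  obtain Y where Y: "definable L S C (length c) Y" "c \<in> Y" "\<forall>c'\<in>Y. conj_over L S C c c'"
    using assms by (auto simp: isolated_def)
  obtain e where e: "e \<in> lists C" "definable L S (set e) (length c) Y"
    using definable_finite_support[OF Y(1)] by auto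
  have "isolated L S c B" if "set e \<subseteq> B" "B \<subseteq> C" for B
    using Y(2,3) definable_mono[OF e(2) that(1)] conj_over_mono[OF _ that(2)]
    unfolding isolated_def by blast
  then show ?thesis using e(1) by blast
qed

section \<open>Elementary substructures\<close>

lemma eval_in_univ:
  assumes "is_structure L S" "e \<in> tuples (univ S) n" "wf_tm L n t"
  shows "eval S e t \<in> univ S"
  using assms(3)
proof (induction t)
  case (Var i)
  then show ?case using assms(2) by (auto simp: tuples_def subset_iff)
next
  case (Fun f ts)
  then have "map (eval S e) ts \<in> tuples (univ S) (length ts)" by (auto simp: tuples_def)
  then show ?case using Fun.prems assms(1) by (auto simp: is_structure_def)
qed

lemma automorphism_eval:
  assumes "is_structure L S" "automorphism L S \<sigma>" "e \<in> tuples (univ S) n" "wf_tm L n t"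
  shows "eval S (map \<sigma> e) t = \<sigma> (eval S e t)"
  using assms(4)
proof (induction t)
  case (Var i)
  then show ?case using assms(3) by (auto simp: tuples_def)
next
  case (Fun f ts)
  have "map (eval S e) ts \<in> tuples (univ S) (length ts)"
    using Fun.prems eval_in_univ[OF assms(1,3)] by (auto simp: tuples_def)
  then have "\<sigma> (Fn S f (map (eval S e) ts)) = Fn S f (map \<sigma> (map (eval S e) ts))"
    using assms(2) Fun.prems by (auto simp: automorphism_def)
  moreover have "map (eval S (map \<sigma> e)) ts = map \<sigma> (map (eval S e) ts)" using Fun by auto
  ultimately show ?case by (simp only: eval.simps)
qed

lemma automorphism_sat:
  assumes "is_structure L S" "automorphism L S \<sigma>" "e \<in> tuples (univ S) n" "wf_fm L n \<phi>"
  shows "sat S (map \<sigma> e) \<phi> \<longleftrightarrow> sat S e \<phi>"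
  using assms(3,4)
proof (induction \<phi> arbitrary: e n)
  case (Equal s t)
  have "inj_on \<sigma> (univ S)" using assms(2) by (auto simp: automorphism_def bij_betw_def)
  moreover have "eval S e s \<in> univ S" "eval S e t \<in> univ S"
    using Equal eval_in_univ[OF assms(1) Equal(1)] by auto
  ultimately show ?case
    using Equal automorphism_eval[OF assms(1,2) Equal(1)] by (auto dest: inj_onD)
next
  case (Rel r ts)
  have "map (eval S e) ts \<in> tuples (univ S) (length ts)"
    using Rel eval_in_univ[OF assms(1) Rel(1)] by (auto simp: tuples_def)
  then have "Rl S r (map (eval S e) ts) \<longleftrightarrow> Rl S r (map \<sigma> (map (eval S e) ts))"
    using assms(2) Rel.prems by (auto simp: automorphism_def)
  moreover have "map (eval S (map \<sigma> e)) ts = map \<sigma> (map (eval S e) ts)"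
    using Rel automorphism_eval[OF assms(1,2) Rel(1)] by auto
  ultimately show ?case by (simp only: sat.simps)
next
  case (Exists \<phi>)
  have im: "\<sigma> ` univ S = univ S" using assms(2) by (auto simp: automorphism_def bij_betw_def)
  have "sat S (map \<sigma> (a # e)) \<phi> \<longleftrightarrow> sat S (a # e) \<phi>" if "a \<in> univ S" for a
    by (rule Exists.IH[of _ "Suc n"]) (use Exists.prems that in \<open>auto simp: tuples_def\<close>)
  moreover have "(\<exists>a\<in>univ S. sat S (a # map \<sigma> e) \<phi>) \<longleftrightarrow> (\<exists>a\<in>univ S. sat S (\<sigma> a # map \<sigma> e) \<phi>)"
    by (subst im[symmetric]) auto
  ultimately show ?case by auto
qed auto

text \<open>Elements of the type outside the structure are junk; fixing them makes automorphisms
  bijections of the whole type.\<close>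

lemma automorphism_auts:
  assumes "is_structure L S" "automorphism L S \<sigma>"
  shows "(\<lambda>x. if x \<in> univ S then \<sigma> x else x) \<in> auts L S {}"
proof -
  let ?\<sigma> = "\<lambda>x. if x \<in> univ S then \<sigma> x else x"
  have b: "bij_betw \<sigma> (univ S) (univ S)" using assms(2) by (simp add: automorphism_def)
  then have "bij_betw ?\<sigma> (univ S) (univ S)" by (rule bij_betw_cong[THEN iffD1, rotated]) simp
  moreover have "bij_betw ?\<sigma> (- univ S) (- univ S)"
    by (rule bij_betw_cong[THEN iffD1, rotated, OF bij_betw_id]) simp
  ultimately have "bij_betw ?\<sigma> (univ S \<union> - univ S) (univ S \<union> - univ S)"
    by (rule bij_betw_combine) auto
  then have "bij ?\<sigma>" by simp
  moreover have "?\<sigma> ` univ S = univ S" using b by (auto simp: bij_betw_def)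
  moreover have "sat S e \<phi> \<longleftrightarrow> sat S (map ?\<sigma> e) \<phi>"
    if "wf_fm L n \<phi>" "e \<in> tuples (univ S) n" for e n \<phi>
  proof -
    have "map ?\<sigma> e = map \<sigma> e" using that(2) by (auto simp: tuples_def)
    then show ?thesis using automorphism_sat[OF assms that(2,1)] by (simp only:)
  qed
  ultimately show ?thesis by (simp add: auts_def)
qed

text \<open>The existential closure of the defining formula is true in \<open>S\<close>, hence in
  \<open>M\<close>, and a witness found in \<open>M\<close> is a point of \<open>Y\<close>.\<close>

lemma elem_substructure_meets:
  assumes "elem_substructure L S M" "definable L S M n Y" "Y \<noteq> {}"
  obtains y where "y \<in> Y" "y \<in> tuples M n"
proof -
  obtain \<phi> c where 1: "c \<in> lists M" "wf_fm L (n + length c) \<phi>"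
    "Y = {b \<in> tuples (univ S) n. sat S (b @ c) \<phi>}" using assms(2) by (rule definableE)
  have "sat S c ((Exists ^^ n) \<phi>)" using assms(3) 1(3) by (auto simp: sat_Exists_funpow)
  then have "sat (induced S M) c ((Exists ^^ n) \<phi>)"
    using assms(1) 1(1,2) unfolding elem_substructure_def
    by (auto simp: tuples_def wf_Exists_funpow)
  then obtain y where y: "y \<in> tuples M n" "sat (induced S M) (y @ c) \<phi>"
    by (auto simp: sat_Exists_funpow)
  moreover have "y @ c \<in> tuples M (n + length c)" using y(1) 1(1) by (auto simp: tuples_def)
  ultimately have "sat S (y @ c) \<phi>"
    using assms(1) 1(2) unfolding elem_substructure_def by blast
  moreover have "y \<in> tuples (univ S) n"
    using y(1) assms(1) tuples_mono unfolding elem_substructure_def by blast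
  ultimately show ?thesis using that y(1) 1(3) by blast
qed

lemma elem_substructure_dcl:
  assumes "elem_substructure L S M" "B \<subseteq> M"
  shows "dcl L S B \<subseteq> M"
proof
  fix a assume "a \<in> dcl L S B"
  then have "definable L S M 1 {[a]}" using definable_mono[OF _ assms(2)] by (auto simp: dcl_def)
  then obtain y where "y \<in> {[a]}" "y \<in> tuples M 1"
    using elem_substructure_meets[OF assms(1)] by blast
  then show "a \<in> M" by (auto simp: tuples_def)
qed

text \<open>Closure under the functions is part of the conclusion: it follows from the test applied
  to the singleton of a function value, which is definable over the arguments.\<close>

lemma Tarski_Vaught:
  assumes "is_structure L S" "N \<subseteq> univ S"
    and ex: "\<And>Y. definable L S N 1 Y \<Longrightarrow> Y \<noteq> {} \<Longrightarrow> \<exists>a\<in>N. [a] \<in> Y"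
  shows "elem_substructure L S N"
proof -
  obtain a where "a \<in> univ S" using assms(1) by (auto simp: is_structure_def)
  then have "[a] \<in> tuples (univ S) 1" by (simp add: tuples_def)
  then have "tuples (univ S) 1 \<noteq> {}" by blast
  then have "N \<noteq> {}" using ex[OF definable_full] by auto
  moreover have "Fn S f b \<in> N" if f: "(f, n) \<in> funs L" "b \<in> tuples N n" for f n b
  proof -
    have b: "b \<in> tuples (univ S) n" using f(2) tuples_mono[OF assms(2)] by blast
    have univ: "Fn S f b \<in> univ S" using assms(1) f(1) b by (auto simp: is_structure_def)
    \<comment> \<open>Index 0 is the value, so the entries of \<open>b\<close> are the variables 1
      to \<open>n\<close>.\<close>
    let ?t = "Fun f (map Var [1..<Suc n])"
    have ev: "map (\<lambda>i. (a # b) ! i) [1..<Suc n] = b" for a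
      using f(2) by (auto simp: tuples_def nth_append nth_Cons' intro!: nth_equalityI simp del: upt_Suc)
    have "map (eval S (a # b)) (map Var [1..<Suc n]) = b" for a
      using ev by (simp add: comp_def del: upt_Suc)
    then have sat: "sat S (a # b) (Equal (Var 0) ?t) \<longleftrightarrow> a = Fn S f b" for a
      by (simp del: upt_Suc map_map)
    have "definable L S N 1 {[Fn S f b]}"
      by (rule definableI[of b _ _ _ "Equal (Var 0) ?t"])
         (use f univ sat in \<open>auto simp: tuples_def length_Suc_conv simp del: sat.simps upt_Suc\<close>)
    then show ?thesis using ex by auto
  qed
  ultimately have st: "is_structure L (induced S N)" by (auto simp: is_structure_def)
  have ev: "eval (induced S N) e t = eval S e t" for e t
  proof (induction t)
    case (Fun f ts)
    then have "map (eval (induced S N) e) ts = map (eval S e) ts" by auto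
    then show ?case by (simp only: eval.simps) simp
  qed simp
  have "sat (induced S N) b \<phi> \<longleftrightarrow> sat S b \<phi>" if "wf_fm L n \<phi>" "b \<in> tuples N n" for n \<phi> b
    using that
  proof (induction \<phi> arbitrary: n b)
    case (Rel r ts)
    have "map (eval (induced S N) b) ts = map (eval S b) ts" by (simp add: ev)
    then show ?case by (simp only: sat.simps) simp
  next
    case (Exists \<phi>)
    have IH: "sat (induced S N) (a # b) \<phi> \<longleftrightarrow> sat S (a # b) \<phi>" if "a \<in> N" for a
      by (rule Exists.IH[of "Suc n"]) (use Exists.prems that in \<open>auto simp: tuples_def\<close>)
    let ?Y = "{x \<in> tuples (univ S) 1. sat S (x @ b) \<phi>}"
    have def: "definable L S N 1 ?Y"
      by (rule definableI[of b]) (use Exists.prems in \<open>auto simp: tuples_def\<close>)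
    show ?case
    proof
      assume "sat S b (Exists \<phi>)"
      then obtain a where "a \<in> univ S" "sat S (a # b) \<phi>" by auto
      then have "[a] \<in> ?Y" by (auto simp: tuples_def)
      then obtain a' where "a' \<in> N" "[a'] \<in> ?Y" using ex[OF def] by blast
      then show "sat (induced S N) b (Exists \<phi>)" using IH by auto
    qed (use IH assms(2) in auto)
  qed (auto simp: ev)
  then show ?thesis using assms(2) st by (auto simp: elem_substructure_def)
qed

lemma auts_elem_embedding:
  assumes "\<sigma> \<in> auts L S B" "\<sigma> ` M \<subseteq> N" "elem_substructure L S M" "elem_substructure L S N"
  shows "elem_embedding L (induced S M) (induced S N) \<sigma>"
proof -
  have "sat (induced S M) b \<phi> \<longleftrightarrow> sat (induced S N) (map \<sigma> b) \<phi>"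
    if "wf_fm L n \<phi>" "b \<in> tuples M n" for n \<phi> b
  proof -
    have "map \<sigma> b \<in> tuples N n" using map_in_tuples assms(2) that(2) by blast
    moreover have "b \<in> lists (univ S)" "wf_fm L (length b) \<phi>"
      using that assms(3) by (auto simp: tuples_def elem_substructure_def)
    ultimately show ?thesis
      using assms(3,4) that auts_sat[OF assms(1)] by (metis elem_substructure_def)
  qed
  then show ?thesis using assms(2) by (simp add: elem_embedding_def)
qed

lemma elem_embedding_partial_elementary:
  assumes "elem_embedding L (induced S M) (induced S N) \<gamma>"
    "elem_substructure L S M" "elem_substructure L S N"
  shows "partial_elementary L S M \<gamma>"
proof -
  have "sat S b \<phi> \<longleftrightarrow> sat S (map \<gamma> b) \<phi>" if "wf_fm L n \<phi>" "b \<in> tuples M n" for n \<phi> b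
  proof -
    have "map \<gamma> b \<in> tuples N n"
      using map_in_tuples that(2) assms(1) unfolding elem_embedding_def
      by (metis fo_struct.select_convs(1) fo_struct.update_convs(1) fo_struct.cases)
    then have "sat (induced S N) (map \<gamma> b) \<phi> \<longleftrightarrow> sat S (map \<gamma> b) \<phi>"
      using assms(3) that(1) unfolding elem_substructure_def by blast
    moreover have "sat (induced S M) b \<phi> \<longleftrightarrow> sat S b \<phi>"
      using assms(2) that unfolding elem_substructure_def by blast
    moreover have "sat (induced S M) b \<phi> \<longleftrightarrow> sat (induced S N) (map \<gamma> b) \<phi>"
      using assms(1) that by (simp add: elem_embedding_def)
    ultimately show ?thesis by blast
  qed
  then show ?thesis using assms by (auto simp: partial_elementary_def elem_embedding_def elem_substructure_def)
qed

section \<open>Totally transcendental homogeneous structures\<close>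

text \<open>Induction on the rank shows that no ranked set has a property \<open>P\<close> which
  always splits into two disjoint sets with \<open>P\<close>. Walking down one branch and collecting
  the siblings gives an infinite disjoint family with \<open>P\<close>, one member of which falls
  under the induction hypothesis.\<close>

lemma totally_transcendental_no_tree:
  assumes "totally_transcendental L S" "P Y"
    and split: "\<And>Y. P Y \<Longrightarrow> definable L S (univ S) n Y \<and> Y \<noteq> {} \<and>
      (\<exists>Y0 Y1. P Y0 \<and> P Y1 \<and> Y0 \<subseteq> Y \<and> Y1 \<subseteq> Y \<and> Y0 \<inter> Y1 = {})"
  shows False
proof -
  have "has_morley_rank L S n Y"
    using assms by (auto simp: totally_transcendental_def)
  then have "\<not> P Y"
  proof (induction rule: has_morley_rank.induct)
    case (1 Y)
    show ?case
    proof
      assume PY: "P Y"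
      obtain s0 s1 where s: "\<And>Y. P Y \<Longrightarrow> P (s0 Y) \<and> P (s1 Y) \<and> s0 Y \<subseteq> Y \<and> s1 Y \<subseteq> Y \<and> s0 Y \<inter> s1 Y = {}"
        using split by metis
      \<comment> \<open>The branch that always takes \<open>s1\<close>; the siblings
        \<open>s0 (W i)\<close> are disjoint because every later one lies inside
        \<open>s1 (W i)\<close>.\<close>
      define W where "W i = (s1 ^^ i) Y" for i
      have PW: "P (W i)" for i
        by (induction i) (use PY s in \<open>auto simp: W_def\<close>)
      have W_Suc: "W (Suc i) = s1 (W i)" for i by (simp add: W_def)
      have W_dec: "W j \<subseteq> W i" if "i \<le> j" for i j
        using that by (induction rule: dec_induct) (use s PW W_Suc in \<open>auto\<close>)
      have disj: "s0 (W i) \<inter> s0 (W j) = {}" if "i < j" for i j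
      proof -
        have "s0 (W j) \<subseteq> s1 (W i)" using s[OF PW] W_dec[of "Suc i" j] that W_Suc by fastforce
        then show ?thesis using s[OF PW[of i]] by blast
      qed
      have "s0 (W i) \<inter> s0 (W j) = {}" if "i \<noteq> j" for i j
        using that disj by (metis inf_commute linorder_neqE_nat)
      moreover have "definable L S (univ S) n (s0 (W i))" "s0 (W i) \<noteq> {}" "s0 (W i) \<subseteq> Y" for i
        using s[OF PW[of i]] split[of "s0 (W i)"] W_dec[of 0 i] by (auto simp: W_def)
      ultimately have "\<exists>i. has_morley_rank L S n (s0 (W i)) \<and> \<not> P (s0 (W i))"
        using 1(2) by (auto dest!: spec[of _ "\<lambda>i. s0 (W i)"])
      then show False using s PW by blast
    qed
  qed
  with \<open>P Y\<close> show False by simp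
qed

locale homogeneous_structure =
  fixes L :: "('f, 'r) lang" and S :: "('a, 'f, 'r) fo_struct" and \<kappa> :: "'k rel"
  assumes struct: "is_structure L S"
    and card: "Card_order \<kappa>" "infinite (Field \<kappa>)"
    and homogeneous: "strongly_homogeneous L \<kappa> S"
begin

lemma small_subset: "small \<kappa> C \<Longrightarrow> B \<subseteq> C \<Longrightarrow> small \<kappa> B"
  unfolding small_def by (meson card_of_mono1 ordLeq_ordLess_trans)

lemma small_Un_finite: "small \<kappa> B \<Longrightarrow> finite F \<Longrightarrow> small \<kappa> (B \<union> F)"
  unfolding small_def
proof (rule card_of_Un_ordLess_infinite_Field[OF card(2,1)])
  assume "finite F"
  then show "|F| <o \<kappa>"
    using card by (intro finite_ordLess_infinite) (auto simp: card_order_on_def[of _ \<kappa>] Field_card_of card_of_well_order_on)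
qed

lemma partial_elementary_extends:
  assumes "partial_elementary L S B f" "small \<kappa> B"
  obtains \<sigma> where "\<sigma> \<in> auts L S {}" "\<And>b. b \<in> B \<Longrightarrow> \<sigma> b = f b"
proof -
  obtain \<sigma> where \<sigma>: "automorphism L S \<sigma>" "\<forall>b\<in>B. \<sigma> b = f b"
    using homogeneous assms unfolding strongly_homogeneous_def by blast
  have "B \<subseteq> univ S" using assms(1) by (simp add: partial_elementary_def)
  with \<sigma>(2) show ?thesis by (intro that[OF automorphism_auts[OF struct \<sigma>(1)]]) auto
qed

text \<open>The map that fixes \<open>B\<close> and sends \<open>c\<close> to \<open>c'\<close> is
  well defined and partial elementary, so homogeneity extends it to an automorphism.\<close>

lemma conj_overI:
  assumes "B \<subseteq> univ S" "small \<kappa> B" "c \<in> tuples (univ S) n" "c' \<in> tuples (univ S) n"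
    and same: "\<And>Y. definable L S B n Y \<Longrightarrow> c \<in> Y \<Longrightarrow> c' \<in> Y"
  shows "conj_over L S B c c'"
proof -
  have len: "length c = n" "length c' = n" using assms(3,4) by (auto simp: tuples_def)
  have sat_iff: "sat S (c @ g) \<phi> \<longleftrightarrow> sat S (c' @ g) \<phi>"
    if "wf_fm L (n + length g) \<phi>" "g \<in> lists B" for \<phi> g
  proof -
    \<comment> \<open>The hypothesis \<open>same\<close> goes one way; using it for
      \<open>\<phi>\<close> and for its negation gives the equivalence.\<close>
    have "definable L S B n {b \<in> tuples (univ S) n. sat S (b @ g) \<phi>}"
      "definable L S B n {b \<in> tuples (univ S) n. sat S (b @ g) (Neg \<phi>)}"
      by (rule definableI[OF that(2), of _ _ \<phi>], use that in auto)
         (rule definableI[OF that(2), of _ _ "Neg \<phi>"], use that in auto)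
    from this[THEN same] show ?thesis using assms(3,4) by auto
  qed
  \<comment> \<open>Entries of \<open>c\<close> may repeat, so one position is chosen for each;
    \<open>c'\<close> repeats them too, since equality of two coordinates is expressible.\<close>
  define idx where "idx x = (SOME i. i < n \<and> c ! i = x)" for x
  have idx: "idx x < n \<and> c ! idx x = x" if "x \<in> set c" for x
    unfolding idx_def by (rule someI_ex) (use that len in \<open>auto simp: in_set_conv_nth\<close>)
  define f where "f x = (if x \<in> set c then c' ! idx x else x)" for x
  have f_nth: "f (c ! i) = c' ! i" if "i < n" for i
  proof -
    have mem: "c ! i \<in> set c" using that len by auto
    have "sat S (c @ []) (Equal (Var (idx (c ! i))) (Var i))"
      using idx[OF mem] by simp
    then have "sat S (c' @ []) (Equal (Var (idx (c ! i))) (Var i))"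
      using idx[OF mem] that by (subst (asm) sat_iff) auto
    then show ?thesis using mem by (simp add: f_def)
  qed
  \<comment> \<open>\<open>B\<close> and \<open>set c\<close> may overlap; at an entry equal to
    \<open>a\<close> the formula saying so forces the same entry of \<open>c'\<close> to be
    \<open>a\<close>.\<close>
  have f_fix: "f a = a" if "a \<in> B" for a
  proof (cases "a \<in> set c")
    case True
    have "sat S (c @ [a]) (Equal (Var (idx a)) (Var n))"
      using idx[OF True] len by (simp add: nth_append)
    then have "sat S (c' @ [a]) (Equal (Var (idx a)) (Var n))"
      using idx[OF True] that by (subst (asm) sat_iff) auto
    then show ?thesis using idx[OF True] True len by (simp add: f_def nth_append)
  qed (simp add: f_def)
  have map_c: "map f c = c'" using f_nth len by (auto intro: nth_equalityI)
  have "sat S h \<phi> \<longleftrightarrow> sat S (map f h) \<phi>" if "wf_fm L m \<phi>" "h \<in> tuples (B \<union> set c) m" for h \<phi> m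
  proof -
    define g where "g = filter (\<lambda>a. a \<in> B) h"
    have "set h \<subseteq> set (c @ g)" using that(2) by (auto simp: g_def tuples_def)
    then obtain \<rho> where \<rho>: "\<forall>i<length h. \<rho> i < length (c @ g)" "h = map (\<lambda>i. (c @ g) ! \<rho> i) [0..<length h]"
      by (rule ex_index_map)
    have m: "length h = m" using that(2) by (simp add: tuples_def)
    have map_g: "map f g = g" by (rule map_idI) (simp add: g_def f_fix)
    have h_nth: "h ! i = (c @ g) ! \<rho> i" if "i < m" for i
      using that \<rho>(2) m by (metis (no_types, lifting) add_0 diff_zero nth_map_upt)
    have "map f h ! i = (c' @ g) ! \<rho> i" if "i < m" for i
    proof -
      have "map f h ! i = map f (c @ g) ! \<rho> i" using that h_nth \<rho>(1) m by (simp del: map_append)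
      then show ?thesis by (simp add: map_c map_g)
    qed
    then have "sat S (c' @ g) (ren_fm \<rho> \<phi>) \<longleftrightarrow> sat S (map f h) \<phi>" by (intro sat_ren_fm[OF that(1)]) simp
    moreover have "sat S (c @ g) (ren_fm \<rho> \<phi>) \<longleftrightarrow> sat S h \<phi>"
      using h_nth by (intro sat_ren_fm[OF that(1)]) simp
    moreover have "wf_fm L (n + length g) (ren_fm \<rho> \<phi>)"
      using \<rho>(1) m len by (intro wf_ren_fm[OF that(1)]) simp
    moreover have "g \<in> lists B" by (auto simp: g_def)
    ultimately show ?thesis using sat_iff by blast
  qed
  moreover have "set c \<subseteq> univ S" "f ` set c \<subseteq> univ S"
    using assms(3,4) map_c by (auto simp: tuples_def list.set_map[symmetric] simp del: list.set_map)
  moreover have "f ` B \<subseteq> univ S" using f_fix assms(1) by auto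
  ultimately have "partial_elementary L S (B \<union> set c) f"
    using assms(1) by (auto simp: partial_elementary_def)
  then obtain \<sigma> where \<sigma>: "\<sigma> \<in> auts L S {}" "\<And>b. b \<in> B \<union> set c \<Longrightarrow> \<sigma> b = f b"
    using partial_elementary_extends small_Un_finite[OF assms(2)] by blast
  have "\<sigma> \<in> auts L S B" using \<sigma> f_fix by (auto simp: auts_def)
  moreover have "map \<sigma> c = c'" using \<sigma>(2) map_c by (metis UnI2 map_cong)
  ultimately show ?thesis by (auto simp: conj_over_def)
qed

lemma separating_definable:
  assumes "B \<subseteq> univ S" "small \<kappa> B" "c \<in> tuples (univ S) n" "c' \<in> tuples (univ S) n"
    "\<not> conj_over L S B c c'"
  obtains Y where "definable L S B n Y" "c \<in> Y" "c' \<notin> Y"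
  using conj_overI assms by blast

text \<open>Otherwise every nonempty \<open>B\<close>-definable subset of \<open>Y\<close> contains
  a tuple that is not isolated, hence also a tuple outside its orbit, and a formula separating the
  two splits the subset.\<close>

lemma isolated_dense:
  assumes tt: "totally_transcendental L S" and B: "B \<subseteq> univ S" "small \<kappa> B"
    and Y: "definable L S B n Y" "Y \<noteq> {}"
  shows "\<exists>Z\<subseteq>Y. definable L S B n Z \<and> Z \<noteq> {} \<and> (\<forall>c\<in>Z. isolated L S c B)"
proof (rule ccontr)
  assume contr: "\<not> ?thesis"
  define P where "P W \<longleftrightarrow> definable L S B n W \<and> W \<noteq> {} \<and> W \<subseteq> Y" for W
  have "P Y" using Y by (simp add: P_def)
  moreover have "definable L S (univ S) n W \<and> W \<noteq> {} \<and>
      (\<exists>Y0 Y1. P Y0 \<and> P Y1 \<and> Y0 \<subseteq> W \<and> Y1 \<subseteq> W \<and> Y0 \<inter> Y1 = {})" if "P W" for W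
  proof -
    have W: "definable L S B n W" "W \<noteq> {}" "W \<subseteq> Y" using that by (auto simp: P_def)
    obtain c where c: "c \<in> W" "\<not> isolated L S c B" using W contr by blast
    have tup: "W \<subseteq> tuples (univ S) n" using W(1) by (rule definable_tuples)
    moreover have "length c = n" using c(1) tup by (auto simp: tuples_def)
    ultimately obtain c' where c': "c' \<in> W" "\<not> conj_over L S B c c'"
      using c W(1) unfolding isolated_def by blast
    obtain V where V: "definable L S B n V" "c \<in> V" "c' \<notin> V"
      using separating_definable[OF B _ _ c'(2)] c(1) c'(1) tup by blast
    have "P (W \<inter> V)" "P (W - V)"
      using W V c(1) c'(1) by (auto simp: P_def intro: definable_Int definable_Diff)
    moreover have "definable L S (univ S) n W" using W(1) B(1) by (rule definable_mono)
    ultimately show ?thesis using W(2) by blast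
  qed
  ultimately show False by (rule totally_transcendental_no_tree[OF tt])
qed

end

section \<open>Constructible sets\<close>

text \<open>\<open>\<T>\<close> collects the stages of a construction of \<open>N\<close> from \<open>A\<close>. It takes the place of a
  well-ordering of \<open>N - A\<close>.\<close>

definition construction ::
  "('f, 'r) lang \<Rightarrow> ('a, 'f, 'r) fo_struct \<Rightarrow> 'a set \<Rightarrow> 'a set \<Rightarrow> 'a set set \<Rightarrow> bool" where
  "construction L S A N \<T> \<longleftrightarrow> A \<in> \<T> \<and> N \<in> \<T> \<and> (\<forall>B\<in>\<T>. A \<subseteq> B \<and> B \<subseteq> N) \<and>
     (\<forall>\<C>. \<C> \<noteq> {} \<and> subset.chain \<T> \<C> \<longrightarrow> \<Union>\<C> \<in> \<T>) \<and>
     (\<forall>B\<in>\<T>. B \<noteq> N \<longrightarrow> (\<exists>c\<in>N - B. insert c B \<in> \<T> \<and> isolated L S [c] B))"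

text \<open>Transfinite iteration of \<open>s\<close> without ordinals. As \<open>s\<close> is
  inflationary but not assumed monotone, the Bourbaki-Witt theorem is the one that applies, with
  unions as suprema.\<close>

lemma exists_tower:
  fixes s :: "'a set \<Rightarrow> 'a set"
  assumes inc: "\<And>B. B \<subseteq> s B" and A: "A \<subseteq> M" and M: "\<forall>B. B \<subseteq> M \<longrightarrow> s B \<subseteq> M"
  shows "\<exists>\<T> N. A \<in> \<T> \<and> N \<in> \<T> \<and> (\<forall>B\<in>\<T>. A \<subseteq> B \<and> B \<subseteq> N \<and> B \<subseteq> M) \<and>
    (\<forall>\<C>. \<C> \<noteq> {} \<and> subset.chain \<T> \<C> \<longrightarrow> \<Union>\<C> \<in> \<T>) \<and>
    (\<forall>B\<in>\<T>. s B \<in> \<T>) \<and> s N = N \<and> (\<forall>B\<in>\<T>. s B = B \<longrightarrow> B = N)"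
proof -
  define r :: "'a set rel" where "r = {(B, C). B \<subseteq> C}"
  have Field: "Field r = UNIV" by (auto simp: r_def Field_def)
  interpret bourbaki_witt_fixpoint Union r s
  proof
    show "Partial_order r"
      unfolding partial_order_on_def preorder_on_def Field
      by (auto simp: r_def refl_on_def trans_def antisym_def)
  qed (use inc in \<open>auto simp: r_def Field[unfolded r_def]\<close>)
  define \<T> N where "\<T> = iterates_above A" and "N = fixp_above A"
  have A_in: "A \<in> \<T>" unfolding \<T>_def by (rule iterates_above.base)
  have N_in: "N \<in> \<T>" unfolding \<T>_def N_def by (rule fixp_iterates_above)
  have sub_N: "B \<subseteq> N" if "B \<in> \<T>" for B
    using that by (auto simp: N_def \<T>_def fixp_above_def Field)
  have A_sub: "A \<subseteq> B" if "B \<in> \<T>" for B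
    using iterates_above_ge[of B A] that by (auto simp: \<T>_def Field) (auto simp: r_def)
  have sub_M: "B \<subseteq> M" if "B \<in> \<T>" for B
    using that unfolding \<T>_def by (induction rule: iterates_above.induct) (use A M in auto)
  have chain: "\<Union>\<C> \<in> \<T>" if "\<C> \<noteq> {}" "subset.chain \<T> \<C>" for \<C>
    unfolding \<T>_def
  proof (rule iterates_above.Sup)
    show "\<C> \<in> Chains r" using that(2) by (auto simp: Chains_def r_def subset_chain_def)
  qed (use that in \<open>auto simp: \<T>_def subset_chain_def\<close>)
  have step: "s B \<in> \<T>" if "B \<in> \<T>" for B
    using that unfolding \<T>_def by (rule iterates_above.step)
  have fix_N: "s N = N" unfolding N_def using fixp_above_unfold[of A] by (simp add: Field)
  \<comment> \<open>Nothing but \<open>B\<close> itself can be reached from a stage \<open>B\<close>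
    fixed by \<open>s\<close>; comparability with the greatest stage \<open>N\<close> then forces
    equality.\<close>
  have uniq: "B = N" if B: "B \<in> \<T>" "s B = B" for B
  proof -
    have "C = B" if "C \<in> iterates_above B" for C
      using that
    proof (induction rule: iterates_above.induct)
      case (Sup \<C>)
      then have "\<C> = {B}" by auto
      then show ?case by simp
    qed (use B in auto)
    moreover have "N \<in> iterates_above B \<or> B \<in> iterates_above N"
      using iterates_above_triangle[of N A B] N_in B(1) by (auto simp: \<T>_def Field)
    moreover have "N \<subseteq> B" if "B \<in> iterates_above N"
      using iterates_above_ge[OF that] by (auto simp: Field) (auto simp: r_def)
    ultimately show ?thesis using sub_N[OF B(1)] by auto
  qed
  show ?thesis
    by (intro exI[of _ \<T>] exI[of _ N])
       (intro conjI ballI allI impI A_in N_in sub_N A_sub sub_M chain step fix_N uniq; simp)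
qed

lemma construction_step:
  assumes "construction L S A N \<T>" "B \<in> \<T>" "B \<noteq> N"
  obtains c where "c \<in> N" "c \<notin> B" "insert c B \<in> \<T>" "isolated L S [c] B"
proof -
  have "\<exists>c\<in>N - B. insert c B \<in> \<T> \<and> isolated L S [c] B"
    using assms by (simp add: construction_def)
  then show ?thesis using that by blast
qed

text \<open>Zorn's lemma replaces induction along the tower, applied to the stages above
  \<open>B\<close> whose tuples are all isolated over \<open>B\<close>. A maximal one is
  \<open>N\<close>, because its next element is isolated over finitely many of its members.\<close>

lemma construction_atomic:
  assumes con: "construction L S A N \<T>" and N: "N \<subseteq> univ S" and B: "B \<in> \<T>"
    and h: "h \<in> lists N"
  shows "isolated L S h B"
proof -
  define \<F> where "\<F> = {C \<in> \<T>. B \<subseteq> C \<and> (\<forall>h\<in>lists C. isolated L S h B)}"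
  have sub: "C \<subseteq> N" if "C \<in> \<T>" for C using con that by (auto simp: construction_def)
  have append: "isolated L S (h @ f) B"
    if "isolated L S h (B \<union> set f)" "isolated L S f B" "set f \<subseteq> N" for h f
    using isolated_append that sub[OF B] N by blast
  have "isolated L S h B" if "h \<in> lists B" for h
    using that
  proof (induction h)
    case (Cons a h)
    have "isolated L S [a] (B \<union> set h)"
      using Cons.hyps sub[OF B] N by (intro isolated_self) auto
    then have "isolated L S ([a] @ h) B"
      using Cons.IH Cons.hyps sub[OF B] by (intro append) auto
    then show ?case by simp
  qed (rule isolated_Nil)
  then have "B \<in> \<F>" using B by (auto simp: \<F>_def)
  then have "\<F> \<noteq> {}" by blast
  moreover have "\<Union>\<C> \<in> \<F>" if \<C>: "\<C> \<noteq> {}" "subset.chain \<F> \<C>" for \<C>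
  proof -
    have "subset.chain \<T> \<C>" using \<C>(2) by (auto simp: subset_chain_def \<F>_def)
    then have "\<Union>\<C> \<in> \<T>" using con \<C>(1) by (auto simp: construction_def)
    moreover have "B \<subseteq> \<Union>\<C>" using \<C> unfolding subset_chain_def \<F>_def by blast
    \<comment> \<open>A tuple is finite, so it already lies in one member of the chain.\<close>
    moreover have "isolated L S h B" if h: "h \<in> lists (\<Union>\<C>)" for h
    proof -
      obtain C where "C \<in> \<C>" "set h \<subseteq> C"
        using finite_subset_Union_chain[OF finite_set _ \<C>] h by blast
      moreover from this have "C \<in> \<F>" using \<C>(2) by (auto simp: subset_chain_def)
      ultimately show ?thesis by (simp add: \<F>_def in_lists_conv_set subset_iff)
    qed
    ultimately show ?thesis by (auto simp: \<F>_def)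
  qed
  ultimately obtain C where C: "C \<in> \<F>" "\<And>X. X \<in> \<F> \<Longrightarrow> C \<subseteq> X \<Longrightarrow> X = C"
    using subset_Zorn_nonempty[of \<F>] by blast
  have "C = N"
  proof (rule ccontr)
    assume "C \<noteq> N"
    moreover have "C \<in> \<T>" using C(1) by (simp add: \<F>_def)
    ultimately obtain c where c: "c \<in> N" "c \<notin> C" "insert c C \<in> \<T>" "isolated L S [c] C"
      using construction_step[OF con] by metis
    have CN: "C \<subseteq> N" "B \<subseteq> C" using C(1) sub by (auto simp: \<F>_def)
    then obtain e where e: "e \<in> lists C"
        "\<forall>B'. set e \<subseteq> B' \<and> B' \<subseteq> C \<longrightarrow> isolated L S [c] B'"
      using isolated_finite_support[OF c(4)] by blast
    have "isolated L S h B" if h: "h \<in> lists (insert c C)" for h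
    proof -
      \<comment> \<open>Both the support \<open>e\<close> of the formula isolating \<open>c\<close>
        and the old entries of \<open>h\<close>: transitivity of isolation passes through
        \<open>f\<close>.\<close>
      define f where "f = e @ filter (\<lambda>x. x \<in> C) h"
      have f: "f \<in> lists C" using e(1) by (auto simp: f_def)
      have "isolated L S ([c] @ f) B"
      proof (rule append)
        show "isolated L S [c] (B \<union> set f)" by (rule e(2)[rule_format]) (use f CN in \<open>auto simp: f_def\<close>)
        show "isolated L S f B" using f C(1) by (auto simp: \<F>_def)
      qed (use f CN in auto)
      then show ?thesis by (rule isolated_subtuple) (use h in \<open>auto simp: f_def\<close>)
    qed
    then have "insert c C \<in> \<F>" using c(3) CN(2) by (auto simp: \<F>_def)
    then show False using C(2) c(2) by blast
  qed
  then show ?thesis using C(1) h by (auto simp: \<F>_def)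
qed

context homogeneous_structure
begin

text \<open>Each step adjoins one element of \<open>M\<close> isolated over the current stage. When
  this stops, density of isolated types makes the result pass the Tarski-Vaught test.\<close>

lemma exists_construction:
  assumes tt: "totally_transcendental L S"
    and M: "elem_substructure L S M" "small \<kappa> M" and A: "A \<subseteq> M"
  obtains N \<T> where "construction L S A N \<T>" "N \<subseteq> M" "elem_substructure L S N"
proof -
  have MS: "M \<subseteq> univ S" using M(1) by (simp add: elem_substructure_def)
  define ok where "ok B c \<longleftrightarrow> c \<in> M - B \<and> isolated L S [c] B" for B c
  define s where "s B = (if \<exists>c. ok B c then insert (SOME c. ok B c) B else B)" for B
  have ok: "ok B (SOME c. ok B c)" if "\<exists>c. ok B c" for B using that by (rule someI_ex)
  have inc: "B \<subseteq> s B" for B by (auto simp: s_def)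
  have sM: "\<forall>B. B \<subseteq> M \<longrightarrow> s B \<subseteq> M" using ok by (auto simp: s_def ok_def)
  obtain \<T> N where T: "A \<in> \<T>" "N \<in> \<T>" "\<forall>B\<in>\<T>. A \<subseteq> B \<and> B \<subseteq> N \<and> B \<subseteq> M"
    "\<forall>\<C>. \<C> \<noteq> {} \<and> subset.chain \<T> \<C> \<longrightarrow> \<Union>\<C> \<in> \<T>"
    "\<forall>B\<in>\<T>. s B \<in> \<T>" "s N = N" "\<forall>B\<in>\<T>. s B = B \<longrightarrow> B = N"
    using exists_tower[OF inc A sM] by (elim exE conjE)
  have "\<exists>c\<in>N - B. insert c B \<in> \<T> \<and> isolated L S [c] B" if B: "B \<in> \<T>" "B \<noteq> N" for B
  proof -
    have ex: "\<exists>c. ok B c" using T(7) B by (auto simp: s_def)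
    define c where "c = (SOME c. ok B c)"
    have "insert c B \<in> \<T>" using T(5)[rule_format, OF B(1)] ex by (simp add: s_def c_def)
    moreover have "ok B c" using ok[OF ex] by (simp add: c_def)
    moreover have "c \<in> N" using T(3) calculation(1) by auto
    ultimately show ?thesis by (auto simp: ok_def)
  qed
  then have "construction L S A N \<T>" unfolding construction_def
    using T(1-4) by (intro conjI) simp_all
  moreover have NM: "N \<subseteq> M" using T(2,3) by blast
  moreover have "elem_substructure L S N"
  proof (rule Tarski_Vaught[OF struct])
    show NS: "N \<subseteq> univ S" using NM MS by auto
    fix Y assume Y: "definable L S N 1 Y" "Y \<noteq> {}"
    \<comment> \<open>\<open>Z\<close> consists of tuples isolated over \<open>N\<close> and meets
      \<open>M\<close>; an element of \<open>M - N\<close> found there would be a candidate for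
      \<open>s\<close>, contradicting \<open>s N = N\<close>.\<close>
    obtain Z where Z: "Z \<subseteq> Y" "definable L S N 1 Z" "Z \<noteq> {}" "\<forall>c\<in>Z. isolated L S c N"
      using isolated_dense[OF tt NS small_subset[OF M(2) NM] Y] by (elim exE conjE)
    obtain y where y: "y \<in> Z" "y \<in> tuples M 1"
      using elem_substructure_meets[OF M(1) definable_mono[OF Z(2) NM] Z(3)] .
    then obtain a where a: "y = [a]" "a \<in> M" by (auto simp: tuples_def length_Suc_conv)
    have "a \<in> N"
    proof (rule ccontr)
      assume "a \<notin> N"
      then have ex: "\<exists>c. ok N c" using a Z(4) y(1) by (auto simp: ok_def)
      define d where "d = (SOME c. ok N c)"
      have "ok N d" unfolding d_def using ex by (rule ok)
      moreover have "insert d N = N" using T(6) ex by (simp add: s_def d_def)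
      ultimately show False by (auto simp: ok_def)
    qed
    then show "\<exists>a\<in>N. [a] \<in> Y" using a y(1) Z(1) by auto
  qed
  ultimately show ?thesis by (rule that)
qed

text \<open>The forth half of a back-and-forth argument along the tower. Adding \<open>d\<close> to
  a stage needs its type isolated over that stage and \<open>b\<close>, which is why atomicity was
  established over every stage.\<close>

lemma construction_extend:
  assumes con: "construction L S A N \<T>"
    and M: "elem_substructure L S M" "small \<kappa> M" and NM: "N \<subseteq> M"
    and b: "b \<in> lists N" and c: "c \<in> lists M" and bc: "conj_over L S A b c"
  obtains \<tau> where "\<tau> \<in> auts L S A" "map \<tau> b = c" "\<tau> ` N \<subseteq> M"
proof -
  have MS: "M \<subseteq> univ S" using M(1) by (simp add: elem_substructure_def)
  have AT: "A \<subseteq> B" "B \<subseteq> N" if "B \<in> \<T>" for B using con that by (auto simp: construction_def)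
  define ok where "ok B \<tau> \<longleftrightarrow> B \<in> \<T> \<and> \<tau> \<in> auts L S A \<and> map \<tau> b = c \<and> \<tau> ` B \<subseteq> M" for B \<tau>
  \<comment> \<open>Zorn's lemma runs on graphs over the stages: automorphisms that differ only off
    the stage are identified, and inclusion is extension of maps.\<close>
  define gr where "gr \<tau> B = (\<lambda>x. (x, \<tau> x)) ` B" for \<tau> :: "'a \<Rightarrow> 'a" and B
  define \<G> where "\<G> = {gr \<tau> B |B \<tau>. ok B \<tau>}"
  obtain \<tau>0 where "\<tau>0 \<in> auts L S A" "map \<tau>0 b = c" using bc by (auto simp: conj_over_def)
  moreover have "A \<in> \<T>" using con by (simp add: construction_def)
  moreover have "\<tau>0 ` A \<subseteq> M" using auts_fix[OF calculation(1)] AT[OF calculation(3)] NM by auto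
  ultimately have "ok A \<tau>0" by (simp add: ok_def)
  then have "\<G> \<noteq> {}" by (auto simp: \<G>_def)
  moreover have "\<Union>\<C> \<in> \<G>" if \<C>: "\<C> \<noteq> {}" "subset.chain \<G> \<C>" for \<C>
  proof -
    define D where "D = fst ` \<Union>\<C>"
    have rep: "\<exists>B \<tau>. G = gr \<tau> B \<and> ok B \<tau>" if "G \<in> \<C>" for G
      using that \<C>(2) by (auto simp: subset_chain_def \<G>_def)
    have fst_gr: "fst ` gr \<tau> B = B" for \<tau> B by (auto simp: gr_def image_image)
    have "fst ` G \<in> \<T>" if "G \<in> \<C>" for G using rep[OF that] fst_gr by (auto simp: ok_def)
    moreover have "fst ` G \<subseteq> fst ` H \<or> fst ` H \<subseteq> fst ` G" if "G \<in> \<C>" "H \<in> \<C>" for G H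
      using \<C>(2) that by (meson image_mono subset_chain_def)
    ultimately have "subset.chain \<T> ((`) fst ` \<C>)" by (simp add: subset_chain_def image_subset_iff)
    then have "\<Union>((`) fst ` \<C>) \<in> \<T>" using con \<C>(1) by (auto simp: construction_def)
    moreover have "\<Union>((`) fst ` \<C>) = D" by (auto simp: D_def)
    ultimately have DT: "D \<in> \<T>" by simp
    have single: "y = y'" if xy: "(x, y) \<in> \<Union>\<C>" "(x, y') \<in> \<Union>\<C>" for x y y'
    proof -
      obtain G where "G \<in> \<C>" "{(x, y), (x, y')} \<subseteq> G"
        using finite_subset_Union_chain[of "{(x, y), (x, y')}", OF _ _ \<C>] xy by blast
      then show ?thesis using rep[of G] by (auto simp: gr_def)
    qed
    \<comment> \<open>The default \<open>\<tau>0\<close> matters only on entries of \<open>b\<close>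
      outside \<open>D\<close>; there it agrees with all automorphisms in the chain, since each
      sends \<open>b\<close> to \<open>c\<close>.\<close>
    define g where "g x = (if x \<in> D then SOME y. (x, y) \<in> \<Union>\<C> else \<tau>0 x)" for x
    have g: "(x, g x) \<in> \<Union>\<C>" if "x \<in> D" for x
    proof -
      have "\<exists>y. (x, y) \<in> \<Union>\<C>" using that by (force simp: D_def)
      from someI_ex[OF this] show ?thesis using that by (simp add: g_def)
    qed
    \<comment> \<open>On a finite tuple \<open>g\<close> acts like a single automorphism from the
      chain, so it is partial elementary on all of \<open>D\<close> and \<open>b\<close>.\<close>
    have loc: "\<exists>\<tau> B. ok B \<tau> \<and> map g h = map \<tau> h" if h: "h \<in> lists (D \<union> set b)" for h
    proof -
      have "(\<lambda>x. (x, g x)) ` (set h \<inter> D) \<subseteq> \<Union>\<C>" using g by auto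
      moreover have "finite ((\<lambda>x. (x, g x)) ` (set h \<inter> D))" by simp
      ultimately obtain G where G: "G \<in> \<C>" "(\<lambda>x. (x, g x)) ` (set h \<inter> D) \<subseteq> G"
        using finite_subset_Union_chain[OF _ _ \<C>] by metis
      obtain B \<tau> where \<tau>: "G = gr \<tau> B" "ok B \<tau>" using rep[OF G(1)] by auto
      have "map \<tau> b = map \<tau>0 b" using \<tau>(2) \<open>map \<tau>0 b = c\<close> by (simp add: ok_def)
      then have "g x = \<tau> x" if "x \<in> set h" for x
        using that h G(2) \<tau>(1) by (cases "x \<in> D") (auto simp: gr_def g_def)
      then have "map g h = map \<tau> h" by simp
      then show ?thesis using \<tau>(2) by blast
    qed
    have DM: "D \<union> set b \<subseteq> M" using AT[OF DT] NM b by auto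
    have "partial_elementary L S (D \<union> set b) g"
      unfolding partial_elementary_def
    proof (intro conjI allI impI ballI)
      show "g ` (D \<union> set b) \<subseteq> univ S"
      proof clarify
        fix x assume x: "x \<in> D \<union> set b"
        then obtain \<tau> B where "ok B \<tau>" "g x = \<tau> x" using loc[of "[x]"] by auto
        then show "g x \<in> univ S" using x DM MS by (auto simp: ok_def auts_in_univ)
      qed
      fix n \<phi> h assume *: "wf_fm L n \<phi>" "h \<in> tuples (D \<union> set b) n"
      then obtain \<tau> B where \<tau>: "ok B \<tau>" "map g h = map \<tau> h" using loc[of h] by (auto simp: tuples_def)
      have "h \<in> lists (univ S)" using * DM MS by (auto simp: tuples_def)
      moreover have "length h = n" using * by (simp add: tuples_def)
      ultimately show "sat S h \<phi> \<longleftrightarrow> sat S (map g h) \<phi>"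
        using auts_sat[of \<tau> L S A h \<phi>] \<tau>(1) *(1) unfolding \<tau>(2) by (simp add: ok_def)
    qed (use DM MS in auto)
    moreover have "small \<kappa> (D \<union> set b)" using M(2) DM by (rule small_subset)
    ultimately obtain \<sigma> where \<sigma>: "\<sigma> \<in> auts L S {}" "\<And>x. x \<in> D \<union> set b \<Longrightarrow> \<sigma> x = g x"
      using partial_elementary_extends by blast
    have "\<sigma> a = a" if "a \<in> A" for a
    proof -
      have "a \<in> D \<union> set b" using that AT[OF DT] by auto
      moreover from this obtain \<tau> B where "ok B \<tau>" "g a = \<tau> a" using loc[of "[a]"] by auto
      ultimately show ?thesis using \<sigma>(2)[of a] that by (auto simp: ok_def auts_fix)
    qed
    then have "\<sigma> \<in> auts L S A" using \<sigma>(1) by (simp add: auts_def)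
    moreover have "map \<sigma> b = c"
    proof -
      obtain \<tau> B where "ok B \<tau>" "map g b = map \<tau> b" using loc[of b] by auto
      moreover have "map \<sigma> b = map g b" using \<sigma>(2) by simp
      ultimately show ?thesis by (simp add: ok_def)
    qed
    moreover have "\<sigma> ` D \<subseteq> M"
    proof clarify
      fix x assume x: "x \<in> D"
      then obtain G where "G \<in> \<C>" "(x, g x) \<in> G" using g by auto
      then have "g x \<in> M" using rep[of G] by (auto simp: gr_def ok_def)
      then show "\<sigma> x \<in> M" using \<sigma>(2) x by simp
    qed
    ultimately have "ok D \<sigma>" using DT by (simp add: ok_def)
    moreover have "\<Union>\<C> = gr \<sigma> D"
    proof (intro equalityI subrelI)
      fix x y assume xy: "(x, y) \<in> \<Union>\<C>"
      then have "x \<in> D" unfolding D_def by (metis fst_conv image_eqI)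
      then show "(x, y) \<in> gr \<sigma> D" using single[OF xy g] \<sigma>(2) by (auto simp: gr_def)
    qed (use g \<sigma>(2) in \<open>auto simp: gr_def\<close>)
    ultimately show ?thesis unfolding \<G>_def by blast
  qed
  ultimately obtain G where G: "G \<in> \<G>" "\<And>H. H \<in> \<G> \<Longrightarrow> G \<subseteq> H \<Longrightarrow> H = G"
    using subset_Zorn_nonempty[of \<G>] by blast
  then obtain B \<tau> where B: "G = gr \<tau> B" "ok B \<tau>" by (auto simp: \<G>_def)
  then have BT: "B \<in> \<T>" and \<tau>: "\<tau> \<in> auts L S A" "map \<tau> b = c" "\<tau> ` B \<subseteq> M"
    by (auto simp: ok_def)
  have "B = N"
  proof (rule ccontr)
    assume "B \<noteq> N"
    then obtain d where d: "d \<in> N" "d \<notin> B" "insert d B \<in> \<T>"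
      using construction_step[OF con BT] by metis
    have NS: "N \<subseteq> univ S" using NM MS by auto
    \<comment> \<open>\<open>b\<close> need not lie in the stage \<open>B\<close>, so
      \<open>d\<close> and \<open>b\<close> are isolated together and \<open>b\<close> is then moved
      to the parameters.\<close>
    have "isolated L S ([d] @ b) B"
      by (rule construction_atomic[OF con NS BT]) (use d b in auto)
    then have "isolated L S [d] (B \<union> set b)" by (rule isolated_right) (use b NS in auto)
    then obtain Y where Y: "definable L S (B \<union> set b) 1 Y" "[d] \<in> Y"
        "\<forall>d'\<in>Y. conj_over L S (B \<union> set b) [d] d'"
      by (auto simp: isolated_def)
    have BbS: "B \<union> set b \<subseteq> univ S" using b NS AT[OF BT] by auto
    \<comment> \<open>The isolating set of \<open>d\<close>, moved by \<open>\<tau>\<close>, has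
      parameters in \<open>M\<close> and so meets \<open>M\<close>; that point is the new image of
      \<open>d\<close>.\<close>
    have "\<tau> ` (B \<union> set b) \<subseteq> M" using \<tau>(2,3) c by auto
    then have "definable L S M 1 (map \<tau> ` Y)"
      using definable_mono[OF auts_definable_image[OF \<tau>(1) Y(1) BbS]] by blast
    then obtain y where y: "y \<in> map \<tau> ` Y" "y \<in> tuples M 1"
      using elem_substructure_meets[OF M(1)] Y(2) by (metis empty_iff image_eqI)
    then obtain d' where d': "d' \<in> Y" "y = map \<tau> d'" by auto
    then obtain \<rho> where \<rho>: "\<rho> \<in> auts L S (B \<union> set b)" "map \<rho> [d] = d'"
      using Y(3) by (auto simp: conj_over_def)
    have \<rho>A: "\<rho> \<in> auts L S A" by (rule auts_mono[OF \<rho>(1)]) (use AT[OF BT] in auto)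
    have eq: "(\<tau> \<circ> \<rho>) x = \<tau> x" if "x \<in> B \<union> set b" for x using auts_fix[OF \<rho>(1) that] by simp
    have "ok (insert d B) (\<tau> \<circ> \<rho>)"
      unfolding ok_def
    proof (intro conjI)
      show "\<tau> \<circ> \<rho> \<in> auts L S A" using \<tau>(1) \<rho>A by (rule auts_comp)
      show "map (\<tau> \<circ> \<rho>) b = c" using eq \<tau>(2) by (metis UnI2 map_cong)
      have "(\<tau> \<circ> \<rho>) d \<in> M" using y(2) d'(2) \<rho>(2) by (auto simp: tuples_def)
      moreover have "(\<tau> \<circ> \<rho>) ` B = \<tau> ` B" using eq by (intro image_cong) auto
      ultimately show "(\<tau> \<circ> \<rho>) ` insert d B \<subseteq> M" using \<tau>(3) by simp
    qed (rule d(3))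
    then have "gr (\<tau> \<circ> \<rho>) (insert d B) \<in> \<G>" by (auto simp: \<G>_def)
    moreover have "G \<subseteq> gr (\<tau> \<circ> \<rho>) (insert d B)" unfolding B(1) gr_def using eq by auto
    ultimately have "gr (\<tau> \<circ> \<rho>) (insert d B) = gr \<tau> B" using G(2) B(1) by blast
    then show False using d(2) by (auto simp: gr_def)
  qed
  then show ?thesis using that \<tau> by blast
qed

end

section \<open>Prime models\<close>

locale prime_model = homogeneous_structure L S \<kappa>
  for L :: "('f, 'r) lang" and S :: "('a, 'f, 'r) fo_struct" and \<kappa> :: "'k rel" +
  fixes A M :: "'a set"
  assumes tt: "totally_transcendental L S"
    and prime: "prime_model_over L \<kappa> S A M"
begin

lemma M_elem: "elem_substructure L S M" and M_small: "small \<kappa> M" and A_sub_M: "A \<subseteq> M"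
  using prime by (auto simp: prime_model_over_def small_model_def)

lemma M_sub_univ: "M \<subseteq> univ S"
  using M_elem by (simp add: elem_substructure_def)

text \<open>Their restrictions to \<open>M\<close> are exactly the elementary self-embeddings over
  \<open>A\<close>; as automorphisms of \<open>S\<close> they have inverses, which need not map
  \<open>M\<close> into \<open>M\<close>.\<close>

definition selfmaps :: "('a \<Rightarrow> 'a) set" where
  "selfmaps = {\<sigma> \<in> auts L S A. \<sigma> ` M \<subseteq> M}"

lemma elem_embedding_auts:
  assumes "elem_embedding L (induced S M) (induced S N) \<gamma>" "elem_substructure L S N"
    "\<forall>a\<in>A. \<gamma> a = a"
  obtains \<sigma> where "\<sigma> \<in> auts L S A" "\<And>x. x \<in> M \<Longrightarrow> \<sigma> x = \<gamma> x"
proof -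
  obtain \<sigma> where \<sigma>: "\<sigma> \<in> auts L S {}" "\<And>x. x \<in> M \<Longrightarrow> \<sigma> x = \<gamma> x"
    using partial_elementary_extends[OF elem_embedding_partial_elementary[OF assms(1) M_elem assms(2)] M_small]
    by blast
  moreover have "\<sigma> \<in> auts L S A" using \<sigma> assms(3) A_sub_M by (auto simp: auts_def)
  ultimately show ?thesis using that by blast
qed

text \<open>Only the image of \<open>M\<close> counts, so each self-embedding may be replaced by an
  automorphism extending it.\<close>

lemma mcl_eq: "mcl L S M A = (\<Inter>\<sigma>\<in>selfmaps. \<sigma> ` M)"
proof (intro equalityI subsetI)
  fix x assume x: "x \<in> mcl L S M A"
  have "x \<in> \<sigma> ` M" if "\<sigma> \<in> selfmaps" for \<sigma>
  proof -
    have "elem_embedding L (induced S M) (induced S M) \<sigma>"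
      using that auts_elem_embedding[OF _ _ M_elem M_elem] by (auto simp: selfmaps_def)
    moreover have "\<forall>a\<in>A. \<sigma> a = a" using that by (auto simp: selfmaps_def auts_fix)
    ultimately show ?thesis using x by (auto simp: mcl_def)
  qed
  then show "x \<in> (\<Inter>\<sigma>\<in>selfmaps. \<sigma> ` M)" by blast
next
  fix x assume x: "x \<in> (\<Inter>\<sigma>\<in>selfmaps. \<sigma> ` M)"
  have "x \<in> \<gamma> ` M"
    if \<gamma>: "elem_embedding L (induced S M) (induced S M) \<gamma>" "\<forall>a\<in>A. \<gamma> a = a" for \<gamma>
  proof -
    obtain \<sigma> where \<sigma>: "\<sigma> \<in> auts L S A" "\<And>x. x \<in> M \<Longrightarrow> \<sigma> x = \<gamma> x"
      using elem_embedding_auts[OF \<gamma>(1) M_elem \<gamma>(2)] by blast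
    then have "\<sigma> ` M = \<gamma> ` M" by simp
    moreover from this have "\<sigma> \<in> selfmaps"
      using \<sigma>(1) \<gamma>(1) by (auto simp: selfmaps_def elem_embedding_def)
    ultimately show ?thesis using x by blast
  qed
  then show "x \<in> mcl L S M A" by (auto simp: mcl_def)
qed

lemma mcl_subset: "mcl L S M A \<subseteq> M"
proof -
  have "id \<in> selfmaps" by (simp add: selfmaps_def auts_id)
  then show ?thesis unfolding mcl_eq by force
qed

lemma A_subset_mcl: "A \<subseteq> mcl L S M A"
  unfolding mcl_eq using A_sub_M by (force simp: selfmaps_def auts_fix intro: rev_image_eqI)

text \<open>The inverse carries a set definable over the image to one definable over
  \<open>M\<close>, where a point is found and moved forward again.\<close>

lemma selfmap_image_elem:
  assumes "\<sigma> \<in> selfmaps"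
  shows "elem_substructure L S (\<sigma> ` M)"
proof (rule Tarski_Vaught[OF struct])
  have \<sigma>: "\<sigma> \<in> auts L S A" "\<sigma> ` M \<subseteq> M" using assms by (auto simp: selfmaps_def)
  show M\<sigma>: "\<sigma> ` M \<subseteq> univ S" using \<sigma>(2) M_sub_univ by auto
  fix Y assume Y: "definable L S (\<sigma> ` M) 1 Y" "Y \<noteq> {}"
  have "inv \<sigma> ` \<sigma> ` M = M" using \<sigma>(1) by (simp add: image_image auts_inv_inv)
  then have "definable L S M 1 (map (inv \<sigma>) ` Y)"
    using auts_definable_image[OF auts_inv[OF \<sigma>(1)] Y(1) M\<sigma>] by simp
  then obtain y where y: "y \<in> map (inv \<sigma>) ` Y" "y \<in> tuples M 1"
    using elem_substructure_meets[OF M_elem] Y(2) by blast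
  then obtain a where a: "y = [a]" "a \<in> M" by (auto simp: tuples_def length_Suc_conv)
  obtain z where z: "z \<in> Y" "y = map (inv \<sigma>) z" using y(1) by blast
  then have "map \<sigma> [a] = z" unfolding a(1)[symmetric] using \<sigma>(1) by (simp add: auts_inv_inv comp_def)
  then show "\<exists>a\<in>\<sigma> ` M. [a] \<in> Y" using a(2) z(1) by auto
qed

text \<open>A prime model need not be presented as a constructible one, but it embeds into a constructible
  elementary substructure of itself, and this suffices for atomicity and homogeneity.\<close>

lemma exists_constructible:
  obtains N \<T> \<gamma> where "construction L S A N \<T>" "N \<subseteq> M" "\<gamma> \<in> auts L S A" "\<gamma> ` M \<subseteq> N"
proof -
  obtain N \<T> where N: "construction L S A N \<T>" "N \<subseteq> M" "elem_substructure L S N"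
    using exists_construction[OF tt M_elem M_small A_sub_M] by blast
  have "A \<subseteq> N" using N(1) by (auto simp: construction_def)
  moreover have "small_model L \<kappa> S N"
    using N(2,3) small_subset[OF M_small] by (simp add: small_model_def)
  ultimately obtain \<gamma> where \<gamma>: "elem_embedding L (induced S M) (induced S N) \<gamma>" "\<forall>a\<in>A. \<gamma> a = a"
    using prime by (auto simp: prime_model_over_def)
  obtain \<sigma> where \<sigma>: "\<sigma> \<in> auts L S A" "\<And>x. x \<in> M \<Longrightarrow> \<sigma> x = \<gamma> x"
    using elem_embedding_auts[OF \<gamma>(1) N(3) \<gamma>(2)] by blast
  moreover have "\<sigma> ` M \<subseteq> N" using \<sigma>(2) \<gamma>(1) by (auto simp: elem_embedding_def)
  ultimately show ?thesis using that N(1,2) by blast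
qed

text \<open>The embedding into a constructible \<open>N\<close> makes \<open>h\<close> isolated
  there; its inverse fixes \<open>A\<close> and brings the isolation back.\<close>

lemma prime_atomic:
  assumes "h \<in> lists M"
  shows "isolated L S h A"
proof -
  obtain N \<T> \<gamma> where N: "construction L S A N \<T>" "N \<subseteq> M" "\<gamma> \<in> auts L S A" "\<gamma> ` M \<subseteq> N"
    by (rule exists_constructible)
  have "A \<in> \<T>" using N(1) by (simp add: construction_def)
  moreover have "N \<subseteq> univ S" using N(2) M_sub_univ by blast
  moreover have "map \<gamma> h \<in> lists N" using N(4) assms by (auto simp: image_subset_iff)
  ultimately have "isolated L S (map \<gamma> h) A" using construction_atomic[OF N(1)] by metis
  then have "isolated L S (map (inv \<gamma>) (map \<gamma> h)) (inv \<gamma> ` A)"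
    using A_sub_M M_sub_univ by (intro isolated_transport[OF auts_inv[OF N(3)]]) auto
  moreover have "inv \<gamma> ` A = A" using auts_fix[OF auts_inv[OF N(3)]] by simp
  ultimately show ?thesis using N(3) by (simp add: auts_inv_inv comp_def)
qed

text \<open>\<open>b\<close> is moved into a constructible \<open>N\<close> first, and the map from
  its image to \<open>c\<close> is extended along \<open>N\<close>. The composite maps
  \<open>M\<close> into \<open>M\<close>, not necessarily onto.\<close>

lemma prime_homogeneous:
  assumes "b \<in> lists M" "c \<in> lists M" "conj_over L S A b c"
  obtains \<delta> where "\<delta> \<in> selfmaps" "map \<delta> b = c"
proof -
  obtain N \<T> \<gamma> where N: "construction L S A N \<T>" "N \<subseteq> M" "\<gamma> \<in> auts L S A" "\<gamma> ` M \<subseteq> N"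
    by (rule exists_constructible)
  have "conj_over L S A b (map \<gamma> b)" using N(3) by (auto simp: conj_over_def)
  then have "conj_over L S A (map \<gamma> b) c" using assms(3) conj_over_sym conj_over_trans by metis
  moreover have "map \<gamma> b \<in> lists N" using N(4) assms(1) by (auto simp: image_subset_iff)
  ultimately obtain \<tau> where \<tau>: "\<tau> \<in> auts L S A" "map \<tau> (map \<gamma> b) = c" "\<tau> ` N \<subseteq> M"
    using construction_extend[OF N(1) M_elem M_small N(2) _ assms(2)] by blast
  have "\<tau> \<circ> \<gamma> \<in> auts L S A" using \<tau>(1) N(3) by (rule auts_comp)
  moreover have "(\<tau> \<circ> \<gamma>) ` M \<subseteq> M" using \<tau>(3) N(4) by fastforce
  ultimately have "\<tau> \<circ> \<gamma> \<in> selfmaps" by (simp add: selfmaps_def)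
  then show ?thesis using that \<tau>(2) by simp
qed

text \<open>If the type of \<open>b\<close> over \<open>D\<close> were not isolated, then every \<open>D\<close>-definable set containing a
  conjugate of \<open>b\<close> over \<open>A\<close> would split into two such sets: the type of the conjugate \<open>c\<close> over \<open>A\<close>
  and the parameters is isolated, but its type over \<open>D\<close> is not, because \<open>D\<close> is invariant.\<close>

lemma isolated_over_invariant:
  assumes D: "A \<subseteq> D" "D \<subseteq> M" "\<And>\<delta>. \<delta> \<in> selfmaps \<Longrightarrow> \<delta> ` D = D" and b: "b \<in> lists M"
  shows "isolated L S b D"
proof (rule ccontr)
  assume not_iso: "\<not> isolated L S b D"
  define n where "n = length b"
  have DS: "D \<subseteq> univ S" "A \<subseteq> univ S" using D(1,2) M_sub_univ by auto
  have D_small: "small \<kappa> D" using M_small D(2) by (rule small_subset)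
  \<comment> \<open>The conjugate is required to lie in \<open>M\<close>, where homogeneity provides
    a self-embedding taking it back to \<open>b\<close>.\<close>
  define P where "P Y \<longleftrightarrow> definable L S D n Y \<and> (\<exists>c\<in>Y. c \<in> lists M \<and> conj_over L S A b c)" for Y
  have "P (tuples (univ S) n)"
    unfolding P_def
  proof (intro conjI bexI[of _ b] definable_full b conj_over_refl)
    show "b \<in> tuples (univ S) n" using b M_sub_univ by (auto simp: tuples_def n_def)
  qed
  moreover have "definable L S (univ S) n Y \<and> Y \<noteq> {} \<and>
      (\<exists>Y0 Y1. P Y0 \<and> P Y1 \<and> Y0 \<subseteq> Y \<and> Y1 \<subseteq> Y \<and> Y0 \<inter> Y1 = {})" if "P Y" for Y
  proof -
    obtain c where Y: "definable L S D n Y" and c: "c \<in> Y" "c \<in> lists M" "conj_over L S A b c"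
      using \<open>P Y\<close> by (auto simp: P_def)
    have Y_tup: "Y \<subseteq> tuples (univ S) n" using Y by (rule definable_tuples)
    have len: "length c = n" using c(1) Y_tup by (auto simp: tuples_def)
    have c_not_iso: "\<not> isolated L S c D"
    proof
      assume iso: "isolated L S c D"
      obtain \<delta> where \<delta>: "\<delta> \<in> selfmaps" "map \<delta> c = b"
        using prime_homogeneous[OF c(2) b conj_over_sym[OF c(3)]] by blast
      then have "isolated L S (map \<delta> c) (\<delta> ` D)"
        using isolated_transport[OF _ iso DS(1)] by (auto simp: selfmaps_def)
      then show False using D(3)[OF \<delta>(1)] \<delta>(2) not_iso by simp
    qed
    obtain e where e: "e \<in> lists D" "definable L S (set e) n Y"
      using definable_finite_support[OF Y] by blast
    have eM: "set e \<subseteq> M" using e(1) D(2) by auto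
    have "isolated L S (c @ e) A" using c(2) eM by (intro prime_atomic) auto
    then have "isolated L S c (A \<union> set e)" using eM M_sub_univ by (intro isolated_right) auto
    then obtain V where V: "definable L S (A \<union> set e) n V" "c \<in> V"
        "\<forall>c'\<in>V. conj_over L S (A \<union> set e) c c'"
      unfolding isolated_def len by blast
    have conj: "conj_over L S A b c'" if "c' \<in> V" for c'
    proof -
      have "conj_over L S A c c'" using V(3) that by (blast intro: conj_over_mono)
      then show ?thesis using c(3) conj_over_trans by blast
    qed
    have VD: "definable L S D n (Y \<inter> V)"
      using Y definable_mono[OF V(1)] D(1) e(1) by (intro definable_Int) auto
    then obtain c' where c': "c' \<in> Y \<inter> V" "\<not> conj_over L S D c c'"
      using c_not_iso c(1) V(2) unfolding isolated_def len by blast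
    have "c \<in> tuples (univ S) n" "c' \<in> tuples (univ S) n" using c(1) c'(1) Y_tup by auto
    then obtain W where W: "definable L S D n W" "c \<in> W" "c' \<notin> W"
      using separating_definable[OF DS(1) D_small _ _ c'(2)] by blast
    \<comment> \<open>\<open>V\<close> contains only conjugates of \<open>b\<close> over
      \<open>A\<close>, so any point of \<open>M\<close> in a subset of \<open>V\<close> is a valid
      witness. This is how both halves regain \<open>P\<close>.\<close>
    have meet: "P Z" if Z: "definable L S D n Z" "Z \<noteq> {}" "Z \<subseteq> V" for Z
    proof -
      obtain z where z: "z \<in> Z" "z \<in> tuples M n"
        using elem_substructure_meets[OF M_elem definable_mono[OF Z(1) D(2)] Z(2)] by blast
      then have "z \<in> lists M" "conj_over L S A b z" using conj Z(3) by (auto simp: tuples_def)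
      then show ?thesis using Z(1) z(1) by (auto simp: P_def)
    qed
    have "P (Y \<inter> V \<inter> W)"
      by (rule meet[OF definable_Int[OF VD W(1)]]) (use c(1) V(2) W(2) in auto)
    moreover have "P (Y \<inter> V - W)"
      by (rule meet[OF definable_Diff[OF VD W(1)]]) (use c' W(3) in auto)
    ultimately show ?thesis using definable_mono[OF Y DS(1)] c(1) by blast
  qed
  ultimately show False by (rule totally_transcendental_no_tree[OF tt])
qed

end

section \<open>Definable Galois extensions\<close>

text \<open>The power \<open>X^m\<close> flattened to tuples of length \<open>m * k\<close>, to
  quantify over \<open>m\<close> points of \<open>X\<close> at once.\<close>

lemma definable_concat:
  assumes "definable L S B k X"
  shows "definable L S B (m * k) {concat xs |xs. xs \<in> lists X \<and> length xs = m}"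
proof (induction m)
  case 0
  have "{concat xs |xs. xs \<in> lists X \<and> length xs = 0} = tuples (univ S) 0"
    by (auto simp: tuples_def)
  then show ?case using definable_full[of L S B 0] by simp
next
  case (Suc m)
  let ?C = "\<lambda>m. {concat xs |xs. xs \<in> lists X \<and> length xs = m}"
  have "{x @ y |x y. x \<in> X \<and> y \<in> ?C m} = ?C (Suc m)"
  proof (intro equalityI subsetI)
    fix z assume "z \<in> {x @ y |x y. x \<in> X \<and> y \<in> ?C m}"
    then obtain x xs where "z = concat (x # xs)" "x # xs \<in> lists X" "length (x # xs) = Suc m"
      by auto
    then show "z \<in> ?C (Suc m)" by blast
  next
    fix z assume "z \<in> ?C (Suc m)"
    then obtain xs where "z = concat xs" "xs \<in> lists X" "length xs = Suc m" by blast
    then show "z \<in> {x @ y |x y. x \<in> X \<and> y \<in> ?C m}" by (cases xs) auto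
  qed
  then show ?case using definable_append[OF assms Suc] by simp
qed

text \<open>That some tuple of points of \<open>X\<close> defines \<open>a\<close> over \<open>C\<close> is a property of \<open>a\<close> expressible over
  \<open>C\<close>, so such a tuple can be found in the elementary substructure \<open>M\<close>.\<close>

lemma dcl_points_elem_substructure:
  assumes M: "elem_substructure L S M" and N: "elem_substructure L S N" "N \<subseteq> M"
    and C: "C \<subseteq> N" and X: "definable L S C k X" and pts: "points X M \<subseteq> lists N"
    and a: "a \<in> M" "a \<in> dcl L S (C \<union> coords X)"
  shows "a \<in> N"
proof -
  have CS: "C \<subseteq> univ S" "M \<subseteq> univ S" using C N M by (auto simp: elem_substructure_def)
  have XS: "X \<subseteq> lists (univ S)" using definable_tuples[OF X] by (auto simp: tuples_def)
  obtain e where e: "e \<in> lists (C \<union> coords X)" "definable L S (set e) 1 {[a]}"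
    using a(2) definable_finite_support by (fastforce simp: dcl_def)
  \<comment> \<open>Single coordinates are completed to whole points of \<open>X\<close>, since only
    membership of whole points in \<open>X\<close> is definable.\<close>
  have "\<exists>xs\<in>lists X. set e \<subseteq> C \<union> set (concat xs)"
    using e(1)
  proof (induction e)
    case Nil
    then show ?case by (intro bexI[of _ "[]"]) auto
  next
    case (Cons y e)
    then obtain xs where xs: "xs \<in> lists X" "set e \<subseteq> C \<union> set (concat xs)" by auto
    show ?case
    proof (cases "y \<in> C")
      case True
      then show ?thesis using xs by (intro bexI[of _ xs]) auto
    next
      case False
      then obtain x where "x \<in> X" "y \<in> set x" using Cons.hyps by (auto simp: coords_def)
      then show ?thesis using xs by (intro bexI[of _ "x # xs"]) auto
    qed
  qed
  then obtain xs where xs: "xs \<in> lists X" "set e \<subseteq> C \<union> set (concat xs)" by blast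
  define w m where "w = concat xs" and "m = length w"
  have wS: "set w \<subseteq> univ S" using xs(1) XS by (fastforce simp: w_def)
  have "definable L S (C \<union> set w) 1 {[a]}" using definable_mono[OF e(2)] xs(2) by (simp add: w_def)
  then obtain Z where Z: "definable L S C (1 + m) Z" "{[a]} = {x. x @ w \<in> Z}"
    using definable_abstract[OF _ CS(1) wS] unfolding m_def by blast
  have m: "m = length xs * k"
  proof -
    have "\<forall>x\<in>set xs. length x = k" using xs(1) definable_tuples[OF X] by (auto simp: tuples_def)
    then show ?thesis unfolding m_def w_def by (induction xs) auto
  qed
  \<comment> \<open>\<open>?bad\<close> collects the \<open>v\<close> for which some tuple other
    than \<open>[a]\<close> solves \<open>Z\<close> at \<open>v\<close>; so \<open>?W\<close>
    consists of the flattened lists of points of \<open>X\<close> that define \<open>a\<close>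
    through \<open>Z\<close>. The parameter \<open>a\<close> lies in \<open>M\<close>, hence
    \<open>?W\<close> meets \<open>M\<close>.\<close>
  let ?Xm = "{concat ys |ys. ys \<in> lists X \<and> length ys = length xs}"
  let ?O = "{x @ v |x v. x \<in> {[a]} \<and> v \<in> tuples (univ S) m}"
  let ?bad = "{v. \<exists>x\<in>tuples (univ S) 1. x @ v \<in> Z - ?O}"
  let ?W = "(?Xm \<inter> {v. [a] @ v \<in> Z}) - ?bad"
  have aS: "[a] \<in> tuples (univ S) 1" "a \<in> univ S" using a(1) CS by (auto simp: tuples_def)
  have "definable L S (C \<union> {a}) m ?Xm"
    unfolding m using X by (intro definable_concat) (rule definable_mono, auto)
  moreover have "definable L S (C \<union> {a}) m {v. [a] @ v \<in> Z}"
    using definable_fix_left[OF Z(1) aS(1)] by simp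
  moreover have "definable L S (C \<union> {a}) m ?bad"
  proof (intro definable_proj definable_Diff definable_append definable_full)
    show "definable L S (C \<union> {a}) (1 + m) Z" using Z(1) by (rule definable_mono) auto
    show "definable L S (C \<union> {a}) 1 {[a]}" using aS(2) by (intro definable_singleton) simp
  qed
  ultimately have "definable L S (C \<union> {a}) m ?W" by (intro definable_Diff definable_Int)
  then have "definable L S M m ?W" by (rule definable_mono) (use C N a in auto)
  moreover have "w \<in> ?W"
  proof -
    have "w \<in> ?Xm" using xs(1) by (auto simp: w_def)
    moreover have "[a] @ w \<in> Z" using Z(2) by blast
    moreover have "w \<in> tuples (univ S) m" using wS by (auto simp: tuples_def m_def)
    then have "w \<notin> ?bad" using Z(2) by auto
    ultimately show ?thesis by blast
  qed
  ultimately obtain v where v: "v \<in> ?W" "v \<in> tuples M m"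
    using elem_substructure_meets[OF M, of m ?W] by blast
  then obtain ys where ys: "v = concat ys" "ys \<in> lists X" by auto
  \<comment> \<open>The points found have all coordinates in \<open>M\<close>, and points of
    \<open>X\<close> in \<open>M\<close> have theirs in \<open>N\<close> by
    \<open>pts\<close>.\<close>
  have "y \<in> lists N" if "y \<in> set ys" for y
  proof -
    have "y \<in> points X M" using that ys v(2) by (auto simp: points_def tuples_def)
    then show ?thesis using pts by auto
  qed
  then have vN: "set v \<subseteq> N" by (auto simp: ys(1))
  have vS: "v \<in> tuples (univ S) m" using v(2) CS(2) tuples_mono by blast
  have "{x. x @ v \<in> Z} = {[a]}"
  proof (intro equalityI subsetI)
    fix x assume x: "x \<in> {x. x @ v \<in> Z}"
    then have "x @ v \<in> tuples (univ S) (1 + m)" using definable_tuples[OF Z(1)] by auto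
    moreover from this have "length x = 1" using vS by (auto simp: tuples_def)
    ultimately have "x \<in> tuples (univ S) 1" by (auto simp: tuples_def)
    then have "x @ v \<in> ?O" using x v(1) by auto
    then obtain u where "x @ v = [a] @ u" "u \<in> tuples (univ S) m" by blast
    moreover from this have "length v = length u" using vS by (simp add: tuples_def)
    ultimately have "x = [a]" by (metis append_eq_append_conv)
    then show "x \<in> {[a]}" by simp
  qed (use v(1) in auto)
  then have "definable L S (C \<union> set v) 1 {[a]}"
    using definable_fix_right[OF Z(1) vS] by simp
  then have "a \<in> dcl L S (C \<union> set v)" by (simp add: dcl_def)
  then show ?thesis using elem_substructure_dcl[OF N(1)] C vN by (meson Un_least subsetD)
qed

section \<open>Action of automorphisms on types and Galois extensions\<close>

abbreviation map_params :: "('a \<Rightarrow> 'a) \<Rightarrow> ('b \<times> 'a list) set \<Rightarrow> ('b \<times> 'a list) set" where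
  "map_params \<sigma> p \<equiv> map_prod id (map \<sigma>) ` p"

lemma map_params_inv:
  fixes p :: "('b \<times> 'a list) set"
  assumes "\<sigma> \<in> auts L S B"
  shows "map_params (inv \<sigma>) (map_params \<sigma> p) = p" "map_params \<sigma> (map_params (inv \<sigma>) p) = p"
proof -
  have "map_prod id (map (inv \<sigma>)) \<circ> map_prod id (map \<sigma>) = (id :: 'b \<times> 'a list \<Rightarrow> _)"
    "map_prod id (map \<sigma>) \<circ> map_prod id (map (inv \<sigma>)) = (id :: 'b \<times> 'a list \<Rightarrow> _)"
    using auts_inv_inv[OF assms] by (auto simp: fun_eq_iff comp_def)
  then show "map_params (inv \<sigma>) (map_params \<sigma> p) = p" "map_params \<sigma> (map_params (inv \<sigma>) p) = p"
    by (simp_all add: image_comp)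
qed

lemma auts_sat_form:
  assumes "\<sigma> \<in> auts L S B'" "B \<subseteq> univ S" "(\<phi>, c) \<in> forms_over L B n" "b \<in> tuples (univ S) n"
  shows "sat S (map \<sigma> b @ map \<sigma> c) \<phi> \<longleftrightarrow> sat S (b @ c) \<phi>"
  using auts_sat[OF assms(1), of "b @ c" \<phi>] assms(2-4) by (auto simp: forms_over_def tuples_def)

lemma complete_type_transport:
  assumes \<sigma>: "\<sigma> \<in> auts L S B'" and B: "B \<subseteq> univ S" and p: "complete_type L S B n p"
  shows "complete_type L S (\<sigma> ` B) n (map_params \<sigma> p)"
proof -
  have sub: "p \<subseteq> forms_over L B n" using p by (simp add: complete_type_def)
  then have "map_params \<sigma> p \<subseteq> forms_over L (\<sigma> ` B) n" by (fastforce simp: forms_over_def)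
  moreover have "\<exists>b\<in>tuples (univ S) n. \<forall>(\<phi>, c)\<in>q. sat S (b @ c) \<phi>"
    if q: "finite q" "q \<subseteq> map_params \<sigma> p" for q
  proof -
    obtain q0 where q0: "q0 \<subseteq> p" "finite q0" "q = map_params \<sigma> q0"
      using finite_subset_image[OF q] by auto
    then obtain b where b: "b \<in> tuples (univ S) n" "\<forall>(\<phi>, c)\<in>q0. sat S (b @ c) \<phi>"
      using p by (auto simp: complete_type_def)
    have "sat S (map \<sigma> b @ map \<sigma> c) \<phi>" if "(\<phi>, c) \<in> q0" for \<phi> c
      using auts_sat_form[OF \<sigma> B _ b(1)] b(2) that q0(1) sub by blast
    moreover have "map \<sigma> b \<in> tuples (univ S) n" using auts_map_tuples[OF \<sigma>] b(1) by blast
    ultimately show ?thesis unfolding q0(3) by (intro bexI[of _ "map \<sigma> b"]) auto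
  qed
  moreover have "(\<phi>, c) \<in> map_params \<sigma> p \<or> (Neg \<phi>, c) \<in> map_params \<sigma> p"
    if c: "(\<phi>, c) \<in> forms_over L (\<sigma> ` B) n" for \<phi> c
  proof -
    have "c \<in> lists (\<sigma> ` B)" using c by (simp add: forms_over_def)
    then have "map (inv \<sigma>) c \<in> lists B" by (fastforce simp: auts_inv_inv(2)[OF \<sigma>])
    then have "(\<phi>, map (inv \<sigma>) c) \<in> forms_over L B n" using c by (simp add: forms_over_def)
    then have "(\<phi>, map (inv \<sigma>) c) \<in> p \<or> (Neg \<phi>, map (inv \<sigma>) c) \<in> p"
      using p by (auto simp: complete_type_def)
    moreover have "c = map \<sigma> (map (inv \<sigma>) c)" using auts_inv_inv[OF \<sigma>] by (simp add: comp_def)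
    ultimately show ?thesis by (metis (no_types, lifting) map_prod_simp id_apply image_eqI)
  qed
  ultimately show ?thesis unfolding complete_type_def by blast
qed

lemma realizations_transport:
  assumes \<sigma>: "\<sigma> \<in> auts L S B'" and B: "B \<subseteq> univ S" and p: "p \<subseteq> forms_over L B n"
  shows "realizations S n (map_params \<sigma> p) = map \<sigma> ` realizations S n p"
proof (intro equalityI subsetI)
  fix b assume b: "b \<in> realizations S n (map_params \<sigma> p)"
  let ?b = "map (inv \<sigma>) b"
  have eq: "map \<sigma> ?b = b" using auts_inv_inv[OF \<sigma>] by (simp add: comp_def)
  have tup: "?b \<in> tuples (univ S) n"
    using b auts_map_tuples[OF auts_inv[OF \<sigma>]] by (auto simp: realizations_def)
  moreover have "sat S (?b @ c) \<phi>" if "(\<phi>, c) \<in> p" for \<phi> c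
  proof -
    have "sat S (b @ map \<sigma> c) \<phi>" using b that by (fastforce simp: realizations_def)
    then show ?thesis using auts_sat_form[OF \<sigma> B _ tup, of \<phi> c] that p eq by auto
  qed
  ultimately have "?b \<in> realizations S n p" by (auto simp: realizations_def)
  then show "b \<in> map \<sigma> ` realizations S n p" using eq by (metis image_eqI)
next
  fix b assume "b \<in> map \<sigma> ` realizations S n p"
  then obtain b0 where b0: "b0 \<in> realizations S n p" "b = map \<sigma> b0" by auto
  have tup: "b0 \<in> tuples (univ S) n" using b0(1) by (simp add: realizations_def)
  then have "b \<in> tuples (univ S) n" using auts_map_tuples[OF \<sigma>] b0(2) by blast
  moreover have "sat S (map \<sigma> b0 @ map \<sigma> c) \<phi>" if "(\<phi>, c) \<in> p" for \<phi> c
    using auts_sat_form[OF \<sigma> B _ tup, of \<phi> c] that p b0(1) by (auto simp: realizations_def)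
  ultimately show "b \<in> realizations S n (map_params \<sigma> p)"
    by (auto simp: realizations_def b0(2))
qed

text \<open>Every clause of the definition is invariant under an automorphism preserving
  \<open>X\<close> as a set. For uniqueness in weak orthogonality a rival extension is pulled back
  along \<open>inv \<sigma>\<close>.\<close>

lemma galois_ext_fin_transport:
  assumes \<sigma>: "\<sigma> \<in> auts L S B" and D: "D \<subseteq> univ S" and X: "X \<subseteq> lists (univ S)" "map \<sigma> ` X = X"
    and E: "galois_ext_fin L S X D E"
  shows "galois_ext_fin L S X (\<sigma> ` D) (\<sigma> ` E)"
proof -
  obtain n p b where p: "complete_type L S D n p" and si: "strongly_internal L S X D n p"
    and wo: "weakly_orthogonal L S X D n p" and b: "b \<in> realizations S n p"
    and E_eq: "E = dcl L S (D \<union> set b)"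
    using E by (auto simp: galois_ext_fin_def)
  have p_sub: "p \<subseteq> forms_over L D n" using p by (simp add: complete_type_def)
  note real = realizations_transport[OF \<sigma> D p_sub]
  have setS: "set b \<subseteq> univ S" if "b \<in> realizations S n p" for b
    using that by (auto simp: realizations_def tuples_def)
  have coordsS: "coords X \<subseteq> univ S" using X(1) by (auto simp: coords_def)
  have coords_im: "\<sigma> ` coords X = coords X"
  proof -
    have "\<sigma> ` coords X = coords (map \<sigma> ` X)" by (auto simp: coords_def)
    then show ?thesis using X(2) by simp
  qed
  have dclX: "\<sigma> ` dcl L S (D \<union> coords X) = dcl L S (\<sigma> ` D \<union> coords X)"
    using auts_dcl_image[OF \<sigma>, of "D \<union> coords X"] D coordsS by (simp add: image_Un coords_im)
  have "complete_type L S (\<sigma> ` D) n (map_params \<sigma> p)"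
    using \<sigma> D p by (rule complete_type_transport)
  moreover have "strongly_internal L S X (\<sigma> ` D) n (map_params \<sigma> p)"
    unfolding strongly_internal_def real
  proof clarify
    fix c c' x assume c: "c \<in> realizations S n p" "c' \<in> realizations S n p" and x: "x \<in> set (map \<sigma> c')"
    have "\<sigma> ` set c' \<subseteq> \<sigma> ` dcl L S (D \<union> coords X \<union> set c)"
      using si c by (intro image_mono) (simp add: strongly_internal_def)
    also have "\<dots> = dcl L S (\<sigma> ` D \<union> coords X \<union> set (map \<sigma> c))"
      using auts_dcl_image[OF \<sigma>, of "D \<union> coords X \<union> set c"] D coordsS setS[OF c(1)]
      by (simp add: image_Un coords_im)
    finally show "x \<in> dcl L S (\<sigma> ` D \<union> coords X \<union> set (map \<sigma> c))" using x by auto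
  qed
  moreover have "weakly_orthogonal L S X (\<sigma> ` D) n (map_params \<sigma> p)"
  proof -
    obtain q where q: "complete_type L S (dcl L S (D \<union> coords X)) n q" "p \<subseteq> q"
      and uniq: "\<And>q'. complete_type L S (dcl L S (D \<union> coords X)) n q' \<Longrightarrow> p \<subseteq> q' \<Longrightarrow> q' = q"
      using wo by (auto simp: weakly_orthogonal_def)
    have q_im: "complete_type L S (dcl L S (\<sigma> ` D \<union> coords X)) n (map_params \<sigma> q)"
      using complete_type_transport[OF \<sigma> dcl_univ q(1)] dclX by simp
    have uniq_im: "q' = map_params \<sigma> q"
      if q': "complete_type L S (dcl L S (\<sigma> ` D \<union> coords X)) n q'" "map_params \<sigma> p \<subseteq> q'" for q'
    proof -
      have "inv \<sigma> ` dcl L S (\<sigma> ` D \<union> coords X) = dcl L S (D \<union> coords X)"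
        unfolding dclX[symmetric] using auts_inv_inv[OF \<sigma>] by (simp add: image_image)
      then have "complete_type L S (dcl L S (D \<union> coords X)) n (map_params (inv \<sigma>) q')"
        using complete_type_transport[OF auts_inv[OF \<sigma>] dcl_univ q'(1)] by simp
      moreover have "p \<subseteq> map_params (inv \<sigma>) q'"
        using image_mono[OF q'(2), of "map_prod id (map (inv \<sigma>))"] map_params_inv[OF \<sigma>] by metis
      ultimately have "map_params (inv \<sigma>) q' = q" by (rule uniq)
      then show ?thesis using map_params_inv(2)[OF \<sigma>] by metis
    qed
    have "map_params \<sigma> p \<subseteq> map_params \<sigma> q" using q(2) by (rule image_mono)
    then show ?thesis
      unfolding weakly_orthogonal_def
      by (intro ex1I[where a = "map_params \<sigma> q"] conjI q_im) (assumption, elim conjE, rule uniq_im)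
  qed
  moreover have "map \<sigma> b \<in> realizations S n (map_params \<sigma> p)" using b real by blast
  moreover have "\<sigma> ` E = dcl L S (\<sigma> ` D \<union> set (map \<sigma> b))"
    unfolding E_eq using auts_dcl_image[OF \<sigma>, of "D \<union> set b"] D setS[OF b] by (simp add: image_Un)
  ultimately show ?thesis unfolding galois_ext_fin_def by blast
qed

text \<open>The empty tuple generates the trivial Galois extension.\<close>

lemma galois_ext_fin_dcl:
  assumes "D \<subseteq> univ S" "X \<subseteq> lists (univ S)"
  shows "galois_ext_fin L S X D (dcl L S D)"
proof -
  have ct: "complete_type L S B 0 (tp L S [] B)" for B :: "'a set"
    by (auto simp: complete_type_def tp_def tuples_def forms_over_def)
  \<comment> \<open>For a formula without free variables finite satisfiability is truth, so a
    complete type in no variables is forced.\<close>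
  have uniq: "q = tp L S [] B" if q: "complete_type L S B 0 q" for q and B :: "'a set"
  proof -
    have sat: "sat S c \<phi>" if "(\<phi>, c) \<in> q" for \<phi> c
    proof -
      have "finite {(\<phi>, c)} \<and> {(\<phi>, c)} \<subseteq> q" using that by simp
      then have "\<exists>b\<in>tuples (univ S) 0. \<forall>(\<phi>, c)\<in>{(\<phi>, c)}. sat S (b @ c) \<phi>"
        using q unfolding complete_type_def by blast
      then show ?thesis by (auto simp: tuples_def)
    qed
    have sub: "q \<subseteq> forms_over L B 0" using q by (simp add: complete_type_def)
    have "(\<phi>, c) \<in> q" if "(\<phi>, c) \<in> forms_over L B 0" "sat S c \<phi>" for \<phi> c
    proof -
      have "(\<phi>, c) \<in> q \<or> (Neg \<phi>, c) \<in> q" using q that(1) by (auto simp: complete_type_def)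
      then show ?thesis using sat[of "Neg \<phi>" c] that(2) by auto
    qed
    then show ?thesis using sat sub by (auto simp: tp_def)
  qed
  have "D \<union> coords X \<subseteq> dcl L S (D \<union> coords X)"
    using assms by (intro dcl_subset) (auto simp: coords_def)
  then have "tp L S [] D \<subseteq> tp L S [] (dcl L S (D \<union> coords X))"
    by (fastforce simp: tp_def forms_over_def)
  then have "weakly_orthogonal L S X D 0 (tp L S [] D)"
    unfolding weakly_orthogonal_def using ct uniq by blast
  moreover have "strongly_internal L S X D 0 (tp L S [] D)"
    by (auto simp: strongly_internal_def realizations_def tuples_def)
  moreover have "[] \<in> realizations S 0 (tp L S [] D)"
    by (auto simp: realizations_def tuples_def tp_def)
  ultimately show ?thesis unfolding galois_ext_fin_def using ct
    by (intro exI[of _ 0] exI[of _ "tp L S [] D"] conjI bexI[of _ "[]"]) auto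
qed

text \<open>The inner union disappears, since an extension of finite type inside \<open>M\<close> is
  an extension by itself.\<close>

lemma XDG_Suc_eq:
  "XDG L S X M A (Suc n) = \<Union>{E. galois_ext_fin L S X (XDG L S X M A n) E \<and> E \<subseteq> M}"
proof -
  have "galois_ext L S X M D E" if "galois_ext_fin L S X D E" "E \<subseteq> M" for D E
    unfolding galois_ext_def using that by (intro exI[of _ "{E}"]) auto
  then have "{E. galois_ext_fin L S X D E \<and> E \<subseteq> M} \<subseteq> {E. galois_ext L S X M D E}" for D by blast
  moreover have "E \<subseteq> \<Union>{E. galois_ext_fin L S X D E \<and> E \<subseteq> M}" if "galois_ext L S X M D E" for D E
    using that unfolding galois_ext_def by blast
  ultimately show ?thesis unfolding XDG.simps by blast
qed

section \<open>Galois extensions inside the minimal closure\<close>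

context prime_model
begin

lemma galois_ext_fin_subset_mcl:
  assumes D: "A \<subseteq> D" "D \<subseteq> mcl L S M A" "\<And>\<delta>. \<delta> \<in> selfmaps \<Longrightarrow> \<delta> ` D = D"
    and X: "definable L S A k X" "points X M = points X (mcl L S M A)"
    and E: "galois_ext_fin L S X D E" "E \<subseteq> M"
  shows "E \<subseteq> mcl L S M A"
proof -
  obtain n p c where p: "complete_type L S D n p" and si: "strongly_internal L S X D n p"
    and c: "c \<in> realizations S n p" and E_eq: "E = dcl L S (D \<union> set c)"
    using E(1) by (auto simp: galois_ext_fin_def)
  have DM: "D \<subseteq> M" "D \<subseteq> univ S" using D(2) mcl_subset M_sub_univ by auto
  have c_tup: "c \<in> tuples (univ S) n" using c by (simp add: realizations_def)
  have "set c \<subseteq> E" unfolding E_eq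
    using dcl_subset[of "D \<union> set c" S L] DM(2) c_tup by (auto simp: tuples_def)
  then have cM: "set c \<subseteq> M" using E(2) by blast
  obtain Y where Y: "definable L S D n Y" "c \<in> Y" "\<forall>c'\<in>Y. conj_over L S D c c'"
    using isolated_over_invariant[OF D(1) DM(1) D(3), of c] cM c_tup
    by (auto simp: isolated_def tuples_def)
  have "E \<subseteq> \<sigma> ` M" if \<sigma>: "\<sigma> \<in> selfmaps" for \<sigma>
  proof -
    let ?N = "\<sigma> ` M"
    have N: "elem_substructure L S ?N" "?N \<subseteq> M" "mcl L S M A \<subseteq> ?N"
      using selfmap_image_elem[OF \<sigma>] \<sigma> by (auto simp: selfmaps_def mcl_eq)
    have DN: "D \<subseteq> ?N" using D(2) N(3) by blast
    obtain c' where c': "c' \<in> Y" "c' \<in> tuples ?N n"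
      using elem_substructure_meets[OF N(1) definable_mono[OF Y(1) DN]] Y(2) by blast
    \<comment> \<open>An automorphism over \<open>D\<close> fixes the parameters of
      \<open>p\<close>, hence \<open>p\<close>, and carries \<open>c\<close> to another
      realization.\<close>
    have "c' \<in> realizations S n p"
    proof -
      obtain \<tau> where \<tau>: "\<tau> \<in> auts L S D" "map \<tau> c = c'" using Y(3) c'(1) by (auto simp: conj_over_def)
      have p_sub: "p \<subseteq> forms_over L D n" using p by (simp add: complete_type_def)
      then have "map_params \<tau> p = p"
        using auts_fix_lists[OF \<tau>(1)] by (force simp: forms_over_def intro!: image_cong[where g = id, simplified])
      then show ?thesis using realizations_transport[OF \<tau>(1) DM(2) p_sub] c \<tau>(2) by auto
    qed
    \<comment> \<open>Internality is used with \<open>c'\<close> as the base tuple and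
      \<open>c\<close> as the target, so that all parameters outside \<open>X\<close> lie in
      \<open>?N\<close>.\<close>
    then have si': "set c \<subseteq> dcl L S (D \<union> coords X \<union> set c')"
      using si c by (auto simp: strongly_internal_def)
    have "a \<in> ?N" if "a \<in> set c" for a
    proof (rule dcl_points_elem_substructure[OF M_elem N(1,2)])
      show "D \<union> set c' \<subseteq> ?N" using DN c'(2) by (auto simp: tuples_def)
      show "definable L S (D \<union> set c') k X" using definable_mono[OF X(1)] D(1) by blast
      show "points X M \<subseteq> lists ?N" unfolding X(2) using N(3) by (auto simp: points_def)
      show "a \<in> M" using that cM by blast
      show "a \<in> dcl L S (D \<union> set c' \<union> coords X)" using si' that by (simp add: Un_ac) blast
    qed
    then have "D \<union> set c \<subseteq> ?N" using DN by blast
    then show ?thesis unfolding E_eq by (rule elem_substructure_dcl[OF N(1)])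
  qed
  then show ?thesis unfolding mcl_eq by blast
qed

text \<open>Inclusion and invariance depend on each other: invariance of a stage gives the inclusion
  of the next one in \<open>mcl L S M A\<close>, and that inclusion gives its invariance.\<close>

lemma XDG_subset_mcl_invariant:
  assumes X: "definable L S A k X" "points X M = points X (mcl L S M A)"
  shows "A \<subseteq> XDG L S X M A n \<and> XDG L S X M A n \<subseteq> mcl L S M A \<and>
    (\<forall>\<delta>\<in>selfmaps. \<delta> ` XDG L S X M A n = XDG L S X M A n) \<and>
    XDG L S X M A n \<subseteq> XDG L S X M A (Suc n)"
proof -
  have AS: "A \<subseteq> univ S" using A_sub_M M_sub_univ by auto
  have XS: "X \<subseteq> lists (univ S)" using definable_tuples[OF X(1)] by (auto simp: tuples_def)
  have step: "D \<subseteq> D'" if "D' = \<Union>{E. galois_ext_fin L S X D E \<and> E \<subseteq> M}" "D \<subseteq> mcl L S M A" for D D'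
  proof -
    have DM: "D \<subseteq> M" "D \<subseteq> univ S" using that(2) mcl_subset M_sub_univ by auto
    then have "galois_ext_fin L S X D (dcl L S D)" "dcl L S D \<subseteq> M" "D \<subseteq> dcl L S D"
      using galois_ext_fin_dcl[OF _ XS] elem_substructure_dcl[OF M_elem] dcl_subset by metis+
    then show ?thesis using that(1) by blast
  qed
  have "A \<subseteq> XDG L S X M A n \<and> XDG L S X M A n \<subseteq> mcl L S M A \<and>
    (\<forall>\<delta>\<in>selfmaps. \<delta> ` XDG L S X M A n = XDG L S X M A n)"
  proof (induction n)
    case 0
    have "\<delta> ` A = A" if "\<delta> \<in> selfmaps" for \<delta> using that auts_fix by (force simp: selfmaps_def)
    then show ?case using A_subset_mcl by simp
  next
    case (Suc n)
    define D D' where "D = XDG L S X M A n" and "D' = XDG L S X M A (Suc n)"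
    have D: "A \<subseteq> D" "D \<subseteq> mcl L S M A" "\<And>\<delta>. \<delta> \<in> selfmaps \<Longrightarrow> \<delta> ` D = D"
      using Suc.IH by (auto simp: D_def)
    have D': "D' = \<Union>{E. galois_ext_fin L S X D E \<and> E \<subseteq> M}"
      unfolding D'_def D_def by (rule XDG_Suc_eq)
    have DS: "D \<subseteq> univ S" using D(2) mcl_subset M_sub_univ by blast
    have mcl: "E \<subseteq> mcl L S M A" if "galois_ext_fin L S X D E" "E \<subseteq> M" for E
      using galois_ext_fin_subset_mcl[OF D X that] .
    have "\<delta> ` D' = D'" if \<delta>: "\<delta> \<in> selfmaps" for \<delta>
    proof -
      have \<delta>A: "\<delta> \<in> auts L S A" "\<delta> ` M \<subseteq> M" using \<delta> by (auto simp: selfmaps_def)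
      \<comment> \<open>\<open>X\<close> is definable over \<open>A\<close>, so automorphisms over
        \<open>A\<close> preserve it as a set.\<close>
      have X_im: "map \<tau> ` X = X" if "\<tau> \<in> auts L S A" for \<tau>
      proof -
        have "map \<tau> c \<in> X \<longleftrightarrow> c \<in> X" for c using auts_definable_iff[OF that X(1) AS] .
        moreover have "c = map \<tau> (map (inv \<tau>) c)" for c
          using auts_inv_inv[OF that] by (simp add: comp_def)
        ultimately show ?thesis by (metis image_eqI subsetI subset_antisym image_subsetI)
      qed
      have "inv \<delta> ` D = inv \<delta> ` \<delta> ` D" using D(3)[OF \<delta>] by simp
      then have inv_D: "inv \<delta> ` D = D" using auts_inv_inv[OF \<delta>A(1)] by (simp add: image_image)
      have "\<delta> ` E \<subseteq> D'" if E: "galois_ext_fin L S X D E" "E \<subseteq> M" for E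
        using galois_ext_fin_transport[OF \<delta>A(1) DS XS X_im[OF \<delta>A(1)] E(1)] E(2) \<delta>A(2) D(3)[OF \<delta>]
        unfolding D' by fastforce
      moreover have "E \<subseteq> \<delta> ` D'" if E: "galois_ext_fin L S X D E" "E \<subseteq> M" for E
      proof -
        have \<delta>inv: "inv \<delta> \<in> auts L S A" using \<delta>A(1) by (rule auts_inv)
        have "E \<subseteq> \<delta> ` M" using mcl[OF E] \<delta> unfolding mcl_eq by blast
        then have "inv \<delta> ` E \<subseteq> M" using auts_inv_inv[OF \<delta>A(1)] by fastforce
        moreover have "galois_ext_fin L S X D (inv \<delta> ` E)"
          using galois_ext_fin_transport[OF \<delta>inv DS XS X_im[OF \<delta>inv] E(1)] inv_D by simp
        ultimately have "inv \<delta> ` E \<subseteq> D'" unfolding D' by blast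
        then have "\<delta> ` inv \<delta> ` E \<subseteq> \<delta> ` D'" by (rule image_mono)
        then show ?thesis using auts_inv_inv[OF \<delta>A(1)] by (simp add: image_image)
      qed
      ultimately show ?thesis unfolding D' by blast
    qed
    moreover have "D' \<subseteq> mcl L S M A" unfolding D' using mcl by blast
    moreover have "A \<subseteq> D'" using D(1) step[OF D' D(2)] by blast
    ultimately show ?case unfolding D'_def[symmetric] by blast
  qed
  moreover from this have "XDG L S X M A n \<subseteq> XDG L S X M A (Suc n)"
    using step[OF XDG_Suc_eq] by (elim conjE)
  ultimately show ?thesis by (elim conjE) (intro conjI; assumption)
qed

lemma normal_inI:
  assumes "A \<subseteq> D" "D \<subseteq> M" "\<And>\<delta>. \<delta> \<in> selfmaps \<Longrightarrow> \<delta> ` D = D"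
  shows "normal_in L S M A D"
  unfolding normal_in_def
proof (intro conjI ballI impI assms(1,2))
  fix b b' assume b: "b \<in> D" "b' \<in> M" and tp: "tp L S [b] A = tp L S [b'] A"
  have AS: "A \<subseteq> univ S" using A_sub_M M_sub_univ by auto
  have "conj_over L S A [b] [b']"
  proof (rule conj_overI[OF AS small_subset[OF M_small A_sub_M], of _ 1])
    show "[b] \<in> tuples (univ S) 1" "[b'] \<in> tuples (univ S) 1"
      using b assms(2) M_sub_univ by (auto simp: tuples_def)
    fix Y assume Y: "definable L S A 1 Y" "[b] \<in> Y"
    obtain \<phi> c where 1: "c \<in> lists A" "wf_fm L (1 + length c) \<phi>"
      "Y = {b \<in> tuples (univ S) 1. sat S (b @ c) \<phi>}" using Y(1) by (rule definableE)
    then have "(\<phi>, c) \<in> tp L S [b] A" using Y(2) by (auto simp: tp_def forms_over_def)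
    then have "sat S ([b'] @ c) \<phi>" unfolding tp by (auto simp: tp_def)
    then show "[b'] \<in> Y" using \<open>[b'] \<in> tuples (univ S) 1\<close> by (simp add: 1(3))
  qed
  then obtain \<delta> where \<delta>: "\<delta> \<in> selfmaps" "map \<delta> [b] = [b']"
    using prime_homogeneous[of "[b]" "[b']"] b assms(2) by auto
  then show "b' \<in> D" using assms(3)[OF \<delta>(1)] b(1) by auto
qed

end

theorem proposition1p11:
  fixes L :: "('f, 'r) lang"
    and T :: "('f, 'r) fm set"
    and \<kappa> :: "'k rel"
    and S :: "('a, 'f, 'r) fo_struct"
    and A M :: "'a set"
    and k :: nat
    and X :: "'a list set"
  assumes "complete_theory L T"
    and "monster L T \<kappa> S"
    and "totally_transcendental L S"
    and "eliminates_imaginaries L S"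
    and "A \<subseteq> univ S"
    and "small \<kappa> A"
    and "dcl L S A = A"
    and "prime_model_over L \<kappa> S A M"
    and "definable L S A k X"
    and "points X M = points X (mcl L S M A)"
  shows "(\<forall>n\<ge>1. XDG L S X M A n \<subseteq> mcl L S M A) \<and>
         A \<subseteq> XDG L S X M A 1 \<and>
         (\<forall>n\<ge>1. XDG L S X M A n \<subseteq> XDG L S X M A (n + 1)) \<and>
         (\<forall>n\<ge>1. XDG L S X M A n \<subseteq> XDG_inf L S X M A) \<and>
         XDG_inf L S X M A \<subseteq> mcl L S M A \<and>
         mcl L S M A \<subseteq> M \<and>
         (\<forall>n\<ge>1. normal_in L S M A (XDG L S X M A n))"
proof -
  \<comment> \<open>\<open>\<kappa>\<close> exceeds the number of formulas, and the equations
    \<open>Equal (Var i) (Var i)\<close> alone are infinitely many.\<close>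
  have "infinite (Field \<kappa>)"
  proof
    assume fin: "finite (Field \<kappa>)"
    let ?F = "{\<phi>. \<exists>n. wf_fm L n \<phi>}"
    have "inj (\<lambda>i. Equal (Var i) (Var i) :: ('f, 'r) fm)" by (auto simp: inj_def)
    then have "infinite (range (\<lambda>i. Equal (Var i) (Var i) :: ('f, 'r) fm))"
      using finite_imageD infinite_UNIV_nat by blast
    moreover have "range (\<lambda>i. Equal (Var i) (Var i)) \<subseteq> ?F" by auto
    ultimately have "infinite ?F" using finite_subset by blast
    moreover have "|?F| \<le>o |Field \<kappa>|"
      using assms(2) ordLess_imp_ordLeq ordLeq_ordIso_trans ordIso_symmetric card_of_Field_ordIso
      unfolding monster_def by metis
    ultimately show False using fin card_of_ordLeq_infinite by blast
  qed
  then interpret prime_model L S \<kappa> A M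
    using assms(2,3,8) by unfold_locales (auto simp: monster_def is_model_def)
  note inv = XDG_subset_mcl_invariant[OF assms(9,10)]
  have XDG: "A \<subseteq> XDG L S X M A n" "XDG L S X M A n \<subseteq> mcl L S M A"
      "XDG L S X M A n \<subseteq> XDG L S X M A (n + 1)" for n
    using inv[of n] unfolding Suc_eq_plus1 by - (elim conjE, assumption)+
  have normal: "normal_in L S M A (XDG L S X M A n)" for n
    by (rule normal_inI[OF XDG(1) subset_trans[OF XDG(2) mcl_subset]])
       (rule inv[of n, THEN conjunct2, THEN conjunct2, THEN conjunct1, rule_format])
  have "XDG_inf L S X M A \<subseteq> mcl L S M A" unfolding XDG_inf_def using XDG(2) by (rule UN_least)
  moreover have "XDG L S X M A n \<subseteq> XDG_inf L S X M A" if "n \<ge> 1" for n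
    unfolding XDG_inf_def using that by blast
  ultimately show ?thesis using XDG mcl_subset normal by blast
qed

end
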